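(* Let $\mathbf{B}_1\in\mathbb{H}^{r\times s}_{r_1}$, $\mathbf{A}_2\in\mathbb{H}^{m\times p}_{r_2}$, $\mathbf{B}_2\in\mathbb{H}^{q\times s}_{r_3}$, $\mathbf{C}\in\mathbb{H}^{m\times s}$, let $\mathbf{N}=\mathbf{B}_2\mathbf{L}_{B_1}$ with $\operatorname{rank}\mathbf{N}=r_4$. Let $\mathbf{X}_1=\mathbf{C}\mathbf{B}_1^\dagger-\mathbf{Q}_{A_2}\mathbf{C}\mathbf{N}^\dagger\mathbf{B}_2\mathbf{B}_1^\dagger=(x^{(1)}_{ij})\in\mathbb{H}^{m\times r}$ and $\mathbf{X}_2=\mathbf{A}_2^\dagger\mathbf{C}\mathbf{N}^\dagger=(x^{(2)}_{gf})\in\mathbb{H}^{p\times q}$. Let $\ddot{\mathbf{a}}^{(2)}_{i.}$ be the $i$th row of $\mathbf{A}_2\mathbf{A}_2^*$; $\mathbf{c}^{(1)}_{i.}$ and $\mathbf{c}^{(2)}_{l.}$ the $i$th row of $\mathbf{C}_1=\mathbf{C}\mathbf{B}_1^*$ and the $l$th row of $\mathbf{C}_2=\mathbf{C}\mathbf{N}^*$; $\tilde{\mathbf{b}}^{(2)}_{t.}$ the $t$th row of $\tilde{\mathbf{B}}_2=\mathbf{B}_2\mathbf{B}_1^*$; and $\mathbf{c}^{(3)}_{.l}$, $\mathbf{c}^{(3)}_{k.}$ the $l$th column and $k$th row of $\mathbf{C}_3=\mathbf{A}_2^*\mathbf{C}\mathbf{N}^*$. Then $$x^{(1)}_{ij}=\frac{\sum_{\alpha\in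 I_{r_1,r}\{j\}}\mathrm{rdet}_j\big((\mathbf{B}_1\mathbf{B}_1^* )_{j.}(\mathbf{c}^{(1)}_{i.})\big)^\alpha_\alpha}{\sum_{\alpha\in I_{r_1,r}}|\mathbf{B}_1\mathbf{B}_1^*|^\alpha_\alpha}-\frac{\sum_{l=1}^m\sum_{t=1}^q x^{(11)}_{il}x^{(12)}_{lt}x^{(13)}_{tj}}{\sum_{\alpha\in I_{r_2,m}}|\mathbf{A}_2\mathbf{A}_2^*|^\alpha_\alpha\sum_{\alpha\in I_{r_4,q}}|\mathbf{N}\mathbf{N}^*|^\alpha_\alpha\sum_{\alpha\in I_{r_1,r}}|\mathbf{B}_1\mathbf{B}_1^*|^\alpha_\alpha},$$ where $x^{(11)}_{il}=\sum_{\alpha\in I_{r_2,m}\{l\}}\mathrm{rdet}_l\big((\mathbf{A}_2\mathbf{A}_2^* )_{l.}(\ddot{\mathbf{a}}^{(2)}_{i.})\big)^\alpha_\alpha$, $x^{(12)}_{lt}=\sum_{\alpha\in I_{r_4,q}\{t\}}\mathrm{rdet}_t\big((\mathbf{N}\mathbf{N}^* )_{t.}(\mathbf{c}^{(2)}_{l.})\big)^\alpha_\alpha$, $x^{(13)}_{tj}=\sum_{\alpha\in I_{r_1,r}\{j\}}\mathrm{rdet}_j\big((\mathbf{B}_1\mathbf{B}_1^* )_{j.}(\tilde{\mathbf{b}}^{(2)}_{t.})\big)^\alpha_\alpha$; and $$x^{(2)}_{gf}=\frac{\sum_{\alpha\in I_{r_4,q}\{f\}}\mathrm{rdet}_f\big((\mathbf{N}\mathbf{N}^*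 )_{f.}(\mathbf{d}^{A_2}_{g.})\big)^\alpha_\alpha}{\sum_{\beta\in J_{r_2,p}}|\mathbf{A}_2^*\mathbf{A}_2|^\beta_\beta\sum_{\alpha\in I_{r_4,q}}|\mathbf{N}\mathbf{N}^*|^\alpha_\alpha}=\frac{\sum_{\beta\in J_{r_2,p}\{g\}}\mathrm{cdet}_g\big((\mathbf{A}_2^*\mathbf{A}_2)_{.g}(\mathbf{d}^{N}_{.f})\big)^\beta_\beta}{\sum_{\beta\in J_{r_2,p}}|\mathbf{A}_2^*\mathbf{A}_2|^\beta_\beta\sum_{\alpha\in I_{r_4,q}}|\mathbf{N}\mathbf{N}^*|^\alpha_\alpha},$$ where $\mathbf{d}^{A_2}_{g.}\in\mathbb{H}^{1\times q}$ has $l$th entry $\sum_{\beta\in J_{r_2,p}\{g\}}\mathrm{cdet}_g\big((\mathbf{A}_2^*\mathbf{A}_2)_{.g}(\mathbf{c}^{(3)}_{.l})\big)^\beta_\beta$ ($l=1,\dots,q$) and $\mathbf{d}^{N}_{.f}\in\mathbb{H}^{p\times1}$ has $k$th entry $\sum_{\alpha\in I_{r_4,q}\{f\}}\mathrm{rdet}_f\big((\mathbf{N}\mathbf{N}^* )_{f.}(\mathbf{c}^{(3)}_{k.})\big)^\alpha_\alpha$ ($k=1,\dots,p$).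
   Context: $\mathbb{H}$ is the skew field of real quaternions; $\mathbb{H}^{m\times n}$ is the set of $m\times n$ matrices over $\mathbb{H}$ and $\mathbb{H}^{m\times n}_r$ the subset of those of rank $r$. $\mathbf{A}^*$ is the conjugate transpose and $\mathbf{A}^\dagger$ the Moore–Penrose inverse (the unique $\mathbf{X}$ with $\mathbf{AXA}=\mathbf{A}$, $\mathbf{XAX}=\mathbf{X}$, $(\mathbf{AX})^*=\mathbf{AX}$, $(\mathbf{XA})^*=\mathbf{XA}$). $\mathbf{L}_A=\mathbf{I}-\mathbf{A}^\dagger\mathbf{A}$, $\mathbf{Q}_A=\mathbf{A}\mathbf{A}^\dagger$. For a matrix $\mathbf{F}$, $\mathbf{F}_{.j}(\mathbf{b})$ (resp. $\mathbf{F}_{i.}(\mathbf{b})$) is $\mathbf{F}$ with its $j$th column (resp. $i$th row) replaced by the column (resp. row) $\mathbf{b}$. Row/column determinants: for $\mathbf{F}=(a_{ij})\in\mathbb{H}^{n\times n}$, $\mathrm{rdet}_i\mathbf{F}=\sum_{\sigma\in S_n}(-1)^{n-r}(a_{i\,i_{k_1}}a_{i_{k_1}i_{k_1+1}}\cdots a_{i_{k_1+l_1}i})\cdots(a_{i_{k_r}i_{k_r+1}}\cdots a_{i_{k_r+l_r}i_{k_r}})$, where $\sigma=(i\,i_{k_1}\,i_{k_1+1}\cdots i_{k_1+l_1})(i_{k_2}\cdots i_{k_2+l_2})\cdots(i_{k_r}\cdots i_{k_r+l_r})$ is the decomposition of $\sigma$ into $r$ disjoint cycles (fixed points included) with $i_{k_2}<\cdots<i_{k_r}$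 and $i_{k_t}<i_{k_t+s}$ for $t=2,\dots,r$, $s=1,\dots,l_t$; and $\mathrm{cdet}_j\mathbf{F}=\sum_{\tau\in S_n}(-1)^{n-r}(a_{j_{k_r}j_{k_r+l_r}}\cdots a_{j_{k_r+1}j_{k_r}})\cdots(a_{j\,j_{k_1+l_1}}\cdots a_{j_{k_1+1}j_{k_1}}a_{j_{k_1}j})$, where $\tau=(j_{k_r+l_r}\cdots j_{k_r+1}\,j_{k_r})\cdots(j_{k_2+l_2}\cdots j_{k_2})(j_{k_1+l_1}\cdots j_{k_1+1}\,j_{k_1}\,j)$ is the decomposition into $r$ disjoint cycles with $j_{k_2}<\cdots<j_{k_r}$ and $j_{k_t}<j_{k_t+s}$ for $t=2,\dots,r$, $s=1,\dots,l_t$. For Hermitian $\mathbf{F}$ all these coincide and are real; this value is $\det\mathbf{F}$. Index sets: $L_{k,n}$ is the set of strictly increasing sequences $\alpha=(\alpha_1<\cdots<\alpha_k)$ in $\{1,\dots,n\}$; $I_{k,m}\{i\}=\{\alpha\in L_{k,m}: i\in\alpha\}$, $J_{k,n}\{j\}=\{\beta\in L_{k,n}: j\in\beta\}$; sums over $J_{k,n}$ or $I_{k,m}$ without braces run over all of $L_{k,n}$, $L_{k,m}$. For a square $\mathbf{F}$, $\mathbf{F}^\alpha_\alpha$ is the principal submatrix with rows and columns indexed by $\alpha$; $\mathrm{cdet}_i(\mathbf{G})^\beta_\beta$ (resp. $\mathrm{rdet}_j(\mathbf{G})^\alpha_\alpha$) is the column (resp. row) determinant of the principal submatrix $\mathbf{G}^\beta_\beta$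 taken at the column (resp. row) coming from index $i$ (resp. $j$); for Hermitian $\mathbf{F}$, $|\mathbf{F}|^\alpha_\alpha=\det\mathbf{F}^\alpha_\alpha$. *)

theory Defs
  imports Complex_Main "Jordan_Normal_Form.Matrix" "Jordan_Normal_Form.DL_Submatrix"
    "HOL-Combinatorics.Permutations"
begin

codatatype quat = Quat (Re: real) (Im1: real) (Im2: real) (Im3: real)

lemma quat_eqI [intro?]:
  "Re x = Re y \<Longrightarrow> Im1 x = Im1 y \<Longrightarrow> Im2 x = Im2 y \<Longrightarrow> Im3 x = Im3 y \<Longrightarrow> x = y"
  by (rule quat.expand) simp

lemma quat_eq_iff:
  "x = y \<longleftrightarrow> Re x = Re y \<and> Im1 x = Im1 y \<and> Im2 x = Im2 y \<and> Im3 x = Im3 y"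
  by (auto intro: quat.expand)

instantiation quat :: ab_group_add
begin
primcorec zero_quat where "Re 0 = 0" | "Im1 0 = 0" | "Im2 0 = 0" | "Im3 0 = 0"
primcorec plus_quat where
  "Re (x + y) = Re x + Re y" | "Im1 (x + y) = Im1 x + Im1 y"
| "Im2 (x + y) = Im2 x + Im2 y" | "Im3 (x + y) = Im3 x + Im3 y"
primcorec uminus_quat where
  "Re (- x) = - Re x" | "Im1 (- x) = - Im1 x" | "Im2 (- x) = - Im2 x" | "Im3 (- x) = - Im3 x"
primcorec minus_quat where
  "Re (x - y) = Re x - Re y" | "Im1 (x - y) = Im1 x - Im1 y"
| "Im2 (x - y) = Im2 x - Im2 y" | "Im3 (x - y) = Im3 x - Im3 y"
instance by standard (simp_all add: quat_eq_iff)
end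

instantiation quat :: ring_1
begin
primcorec one_quat where "Re 1 = 1" | "Im1 1 = 0" | "Im2 1 = 0" | "Im3 1 = 0"
primcorec times_quat where
  "Re (a * b) = Re a * Re b - Im1 a * Im1 b - Im2 a * Im2 b - Im3 a * Im3 b"
| "Im1 (a * b) = Re a * Im1 b + Im1 a * Re b + Im2 a * Im3 b - Im3 a * Im2 b"
| "Im2 (a * b) = Re a * Im2 b - Im1 a * Im3 b + Im2 a * Re b + Im3 a * Im1 b"
| "Im3 (a * b) = Re a * Im3 b + Im1 a * Im2 b - Im2 a * Im1 b + Im3 a * Re b"
instance by standard (simp_all add: quat_eq_iff algebra_simps)
end

primcorec cnj :: "quat \<Rightarrow> quat" where
  "Re (cnj x) = Re x" | "Im1 (cnj x) = - Im1 x" | "Im2 (cnj x) = - Im2 x" | "Im3 (cnj x) = - Im3 x"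

instantiation quat :: division_ring
begin
definition quat_nsq :: "quat \<Rightarrow> real" where
  "quat_nsq x = (Re x)\<^sup>2 + (Im1 x)\<^sup>2 + (Im2 x)\<^sup>2 + (Im3 x)\<^sup>2"
primcorec inverse_quat where
  "Re (inverse x) = Re x / quat_nsq x" | "Im1 (inverse x) = - Im1 x / quat_nsq x"
| "Im2 (inverse x) = - Im2 x / quat_nsq x" | "Im3 (inverse x) = - Im3 x / quat_nsq x"
definition divide_quat :: "quat \<Rightarrow> quat \<Rightarrow> quat" where
  "divide_quat x y = x * inverse y"
instance
proof
  fix x :: quat
  assume "x \<noteq> 0"
  hence n: "quat_nsq x \<noteq> 0"
    by (auto simp: quat_nsq_def quat_eq_iff add_nonneg_eq_0_iff)
  show "inverse x * x = 1" using n
    by (simp add: quat_eq_iff field_simps) (simp add: quat_nsq_def power2_eq_square)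
  show "x * inverse x = 1" using n
    by (simp add: quat_eq_iff field_simps) (simp add: quat_nsq_def power2_eq_square)
next
  show "inverse (0::quat) = 0" by (simp add: quat_eq_iff)
next
  fix x y :: quat show "x div y = x * inverse y" by (simp add: divide_quat_def)
qed
end

definition ctrans :: "quat mat \<Rightarrow> quat mat" where
  "ctrans A = map_mat cnj (transpose_mat A)"

definition mpinv :: "quat mat \<Rightarrow> quat mat" where
  "mpinv A = (THE X. X \<in> carrier_mat (dim_col A) (dim_row A) \<and>
      A * X * A = A \<and> X * A * X = X \<and> ctrans (A * X) = A * X \<and> ctrans (X * A) = X * A)"

definition right_indep_cols :: "quat mat \<Rightarrow> nat set \<Rightarrow> bool" where
  "right_indep_cols A S \<longleftrightarrow> (\<forall>c :: nat \<Rightarrow> quat.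
      (\<forall>i < dim_row A. (\<Sum>j\<in>S. A $$ (i, j) * c j) = 0) \<longrightarrow> (\<forall>j\<in>S. c j = 0))"

definition qrank :: "quat mat \<Rightarrow> nat" where
  "qrank A = Max (card ` {S. S \<subseteq> {0..<dim_col A} \<and> right_indep_cols A S})"

definition L_mat :: "quat mat \<Rightarrow> quat mat" where
  "L_mat A = 1\<^sub>m (dim_col A) - mpinv A * A"

definition Q_mat :: "quat mat \<Rightarrow> quat mat" where
  "Q_mat A = A * mpinv A"

definition repl_row :: "quat mat \<Rightarrow> nat \<Rightarrow> quat vec \<Rightarrow> quat mat" where
  "repl_row A i b = mat (dim_row A) (dim_col A) (\<lambda>(k, l). if k = i then b $ l else A $$ (k, l))"

definition repl_col :: "quat mat \<Rightarrow> nat \<Rightarrow> quat vec \<Rightarrow> quat mat" where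
  "repl_col A j b = mat (dim_row A) (dim_col A) (\<lambda>(k, l). if l = j then b $ k else A $$ (k, l))"

definition orb_len :: "(nat \<Rightarrow> nat) \<Rightarrow> nat \<Rightarrow> nat" where
  "orb_len s x = (LEAST k. 0 < k \<and> (s ^^ k) x = x)"

definition cyc :: "(nat \<Rightarrow> nat) \<Rightarrow> nat \<Rightarrow> nat list" where
  "cyc s x = map (\<lambda>k. (s ^^ k) x) [0..<orb_len s x]"

definition cyc_leaders :: "nat \<Rightarrow> (nat \<Rightarrow> nat) \<Rightarrow> nat \<Rightarrow> nat list" where
  "cyc_leaders n s i = sorted_list_of_set
     {m \<in> {0..<n}. m \<notin> set (cyc s i) \<and> (\<forall>k. m \<le> (s ^^ k) m)}"

text \<open>Order in which the factors a_{x, s x} occur in the rdet / cdet monomial of s.\<close>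
definition rdet_seq :: "nat \<Rightarrow> (nat \<Rightarrow> nat) \<Rightarrow> nat \<Rightarrow> nat list" where
  "rdet_seq n s i = cyc s i @ concat (map (cyc s) (cyc_leaders n s i))"

definition cdet_seq :: "nat \<Rightarrow> (nat \<Rightarrow> nat) \<Rightarrow> nat \<Rightarrow> nat list" where
  "cdet_seq n s j = concat (map (cyc s) (rev (cyc_leaders n s j))) @ cyc s j"

text \<open>(-1)^(n-r) with r the number of cycles equals the sign of the permutation.\<close>
definition rdet :: "nat \<Rightarrow> quat mat \<Rightarrow> quat" where
  "rdet i F = (\<Sum>s | s permutes {0..<dim_row F}.
      of_int (sign s) * prod_list (map (\<lambda>x. F $$ (x, s x)) (rdet_seq (dim_row F) s i)))"

definition cdet :: "nat \<Rightarrow> quat mat \<Rightarrow> quat" where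
  "cdet j F = (\<Sum>s | s permutes {0..<dim_row F}.
      of_int (sign s) * prod_list (map (\<lambda>x. F $$ (x, s x)) (cdet_seq (dim_row F) s j)))"

text \<open>Determinant of a Hermitian matrix (common value of all rdet_i / cdet_j);
  the empty matrix has determinant 1.\<close>
definition hdet :: "quat mat \<Rightarrow> quat" where
  "hdet F = (if dim_row F = 0 then 1 else rdet 0 F)"

text \<open>Principal submatrices indexed by a set of indices, and row/column determinants
  of them taken at the row/column coming from index i.\<close>
definition princ :: "quat mat \<Rightarrow> nat set \<Rightarrow> quat mat" where
  "princ F \<alpha> = submatrix F \<alpha> \<alpha>"

definition rdet_sub :: "nat \<Rightarrow> quat mat \<Rightarrow> nat set \<Rightarrow> quat" where
  "rdet_sub i F \<alpha> = rdet (card {a \<in> \<alpha>. a < i}) (princ F \<alpha>)"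

definition cdet_sub :: "nat \<Rightarrow> quat mat \<Rightarrow> nat set \<Rightarrow> quat" where
  "cdet_sub j F \<alpha> = cdet (card {a \<in> \<alpha>. a < j}) (princ F \<alpha>)"

definition Lkn :: "nat \<Rightarrow> nat \<Rightarrow> nat set set" where
  "Lkn k n = {\<alpha>. \<alpha> \<subseteq> {0..<n} \<and> card \<alpha> = k}"

definition Ikn :: "nat \<Rightarrow> nat \<Rightarrow> nat \<Rightarrow> nat set set" where
  "Ikn k n i = {\<alpha> \<in> Lkn k n. i \<in> \<alpha>}"

definition pminors :: "nat \<Rightarrow> quat mat \<Rightarrow> quat" where
  "pminors k F = (\<Sum>\<alpha>\<in>Lkn k (dim_row F). hdet (princ F \<alpha>))"

end

theory Submission
  imports Defs "HOL-Combinatorics.Orbits"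
begin

text \<open>
  Let \<open>F = B B\<^sup>*\<close>, let \<open>d\<^sub>k\<close> be the sum of its principal minors of order \<open>k\<close>, and let
  \<open>M\<^sub>k\<close> be the matrix of the left linear map sending a row \<open>b\<close> to
  \<open>(\<Sum>\<^sub>\<alpha> rdet\<^sub>j (F\<^sub>j\<^sub>.(b))\<^sub>\<alpha>)\<^sub>j\<close>, where \<open>\<alpha>\<close> ranges over the index sets of size \<open>k\<close> containing \<open>j\<close>.
  Expanding the row determinant over the cycle through \<open>j\<close>, and pairing each cycle with its
  reversal, gives Cramer's rule for Hermitian matrices, which reads
  \<open>M\<^bsub>k+1\<^esub> = d\<^sub>k I - F M\<^sub>k\<close>; moreover \<open>M\<^bsub>n+1\<^esub> = 0\<close>. If \<open>r\<close> is maximal with \<open>d\<^sub>r \<noteq> 0\<close>, then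
  \<open>F M\<^bsub>r+1\<^esub> = 0\<close> because \<open>F\<close> is Hermitian, hence \<open>F M\<^sub>r / d\<^sub>r\<close> is the orthogonal projection onto
  the range of \<open>F\<close> and \<open>B\<^sup>* M\<^sub>r / d\<^sub>r\<close> is the Moore-Penrose inverse of \<open>B\<close>. Comparing traces
  identifies \<open>r\<close> with the rank of \<open>B\<close>. Column determinants are conjugates of row determinants of
  the adjoint, and the theorem follows by applying these formulas to each factor of
  \<open>X\<^sub>1\<close> and \<open>X\<^sub>2\<close>.
\<close>

section \<open>Quaternions and path sums\<close>

instantiation quat :: real_div_algebra
begin
primcorec scaleR_quat where
  "Re (scaleR a x) = a * Re x" | "Im1 (scaleR a x) = a * Im1 x"
| "Im2 (scaleR a x) = a * Im2 x" | "Im3 (scaleR a x) = a * Im3 x"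
instance by standard (simp_all add: quat_eq_iff algebra_simps)
end

section \<open>Conjugation and real quaternions\<close>

lemma quat_of_real_simps [simp]:
  "Re (of_real a) = a" "Im1 (of_real a) = 0" "Im2 (of_real a) = 0" "Im3 (of_real a) = 0"
  by (simp_all add: of_real_def)

lemma quat_real_commute: "of_real a * x = x * (of_real a :: quat)"
  by (simp add: quat_eq_iff)

lemma cnj_simps [simp]:
  "cnj (x + y) = cnj x + cnj y" "cnj (x - y) = cnj x - cnj y" "cnj (- x) = - cnj x"
  "cnj 0 = 0" "cnj 1 = 1" "cnj (cnj x) = x" "cnj (of_real a) = of_real a"
  by (simp_all add: quat_eq_iff)

lemma cnj_mult: "cnj (x * y) = cnj y * cnj x"
  by (simp add: quat_eq_iff algebra_simps)

lemma cnj_sum: "cnj (sum f A) = (\<Sum>x\<in>A. cnj (f x))"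
  by (induction A rule: infinite_finite_induct) auto

lemma Re_sum: "Re (sum f A) = (\<Sum>x\<in>A. Re (f x))"
  by (induction A rule: infinite_finite_induct) auto

lemma cnj_prod_list: "cnj (prod_list xs) = prod_list (rev (map cnj xs))"
  by (induction xs) (auto simp: cnj_mult)

lemma self_cnj_iff: "cnj x = x \<longleftrightarrow> x = of_real (Re x)"
  by (auto simp: quat_eq_iff)

lemma Re_mult_commute: "Re (x * y) = Re (y * x)"
  by (simp add: algebra_simps)

lemma quat_neg1_power [simp]:
  "Re ((-1) ^ n) = (-1) ^ n" "Im1 ((-1) ^ n) = 0" "Im2 ((-1) ^ n) = 0" "Im3 ((-1) ^ n) = 0"
  by (induction n) auto

section \<open>Sums over simple paths\<close>

definition paths :: "nat set \<Rightarrow> nat list set" where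
  "paths A = {xs. distinct xs \<and> set xs \<subseteq> A}"

lemma finite_paths [simp]: "finite A \<Longrightarrow> finite (paths A)"
  unfolding paths_def using finite_subset_distinct[of A] by (simp add: conj_commute)

text \<open>A simple path either avoids \<open>i\<close> or splits uniquely at \<open>i\<close>.
  Choosing the tail \<open>vs\<close> first leaves an inner sum over \<open>us\<close> that can be
  read as a sum over cycles through \<open>i\<close>, or over arcs ending at
  \<open>i\<close>.\<close>

lemma sum_paths_split:
  fixes g :: "nat list \<Rightarrow> 'a :: comm_monoid_add"
  assumes fin: "finite B" and i: "i \<in> B"
  shows "sum g (paths B) = sum g (paths (B - {i}))
    + (\<Sum>vs\<in>paths (B - {i}). \<Sum>us\<in>paths (B - {i} - set vs). g (us @ i # vs))"
proof -
  let ?S = "SIGMA vs : paths (B - {i}). paths (B - {i} - set vs)"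
  let ?f = "\<lambda>(vs, us). us @ i # vs"
  have inj: "inj_on ?f ?S"
  proof (rule inj_onI, clarsimp)
    fix us vs us' vs'
    assume a: "vs \<in> paths (B - {i})" "us \<in> paths (B - {i} - set vs)" "vs' \<in> paths (B - {i})"
      "us' \<in> paths (B - {i} - set vs')" "us @ i # vs = us' @ i # vs'"
    hence "i \<notin> set us" "i \<notin> set us'" "i \<notin> set vs" by (auto simp: paths_def)
    thus "vs = vs' \<and> us = us'" using a(5) by (metis append_Cons_eq_iff)
  qed
  have eq: "paths B = paths (B - {i}) \<union> ?f ` ?S"
  proof (intro equalityI subsetI)
    fix xs assume xs: "xs \<in> paths B"
    show "xs \<in> paths (B - {i}) \<union> ?f ` ?S"
    proof (cases "i \<in> set xs")
      case False thus ?thesis using xs by (auto simp: paths_def)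
    next
      case True
      then obtain us vs where e: "xs = us @ i # vs" by (meson split_list)
      have "(vs, us) \<in> ?S" using xs by (auto simp: e paths_def)
      thus ?thesis unfolding e by force
    qed
  next
    fix xs assume "xs \<in> paths (B - {i}) \<union> ?f ` ?S"
    thus "xs \<in> paths B" using i by (auto simp: paths_def)
  qed
  have disj: "paths (B - {i}) \<inter> ?f ` ?S = {}" by (auto simp: paths_def)
  have finS: "finite ?S" using fin by auto
  have "sum g (paths B) = sum g (paths (B - {i})) + sum g (?f ` ?S)"
    unfolding eq by (rule sum.union_disjoint) (use fin finS disj in auto)
  also have "sum g (?f ` ?S) = (\<Sum>(vs, us)\<in>?S. g (us @ i # vs))"
    by (subst sum.reindex[OF inj]) (auto intro!: sum.cong)
  also have "\<dots> = (\<Sum>vs\<in>paths (B - {i}). \<Sum>us\<in>paths (B - {i} - set vs). g (us @ i # vs))"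
    by (rule sum.Sigma[symmetric]) (use fin in auto)
  finally show ?thesis .
qed

text \<open>Both sides run over ordered pairs of disjoint simple paths. This is the source of the
  symmetry in \<open>avoiding_commute\<close> and \<open>meeting_commute\<close>.\<close>

lemma sum_paths_swap:
  fixes h :: "nat list \<Rightarrow> nat list \<Rightarrow> 'a :: comm_monoid_add"
  assumes fin: "finite B"
  shows "(\<Sum>vs\<in>paths B. \<Sum>us\<in>paths (B - set vs). h us vs)
       = (\<Sum>us\<in>paths B. \<Sum>vs\<in>paths (B - set us). h us vs)"
proof -
  have "(\<Sum>vs\<in>paths B. \<Sum>us\<in>paths (B - set vs). h us vs)
     = (\<Sum>(vs, us)\<in>(SIGMA vs : paths B. paths (B - set vs)). h us vs)"
    by (rule sum.Sigma) (use fin in auto)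
  also have "\<dots> = (\<Sum>(us, vs)\<in>(SIGMA us : paths B. paths (B - set us)). h us vs)"
    by (rule sum.reindex_bij_witness[where i = prod.swap and j = prod.swap]) (auto simp: paths_def)
  also have "\<dots> = (\<Sum>us\<in>paths B. \<Sum>vs\<in>paths (B - set us). h us vs)"
    by (rule sum.Sigma[symmetric]) (use fin in auto)
  finally show ?thesis .
qed

lemma sum_paths_rev: "(\<Sum>ys\<in>paths B. g (rev ys)) = sum g (paths B)"
  by (rule sum.reindex_bij_witness[where i = rev and j = rev]) (auto simp: paths_def)

lemma sum_paths_first:
  fixes g :: "nat list \<Rightarrow> 'a :: comm_monoid_add"
  assumes fin: "finite B"
  shows "sum g (paths B) = g [] + (\<Sum>x\<in>B. \<Sum>ys\<in>paths (B - {x}). g (x # ys))"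
proof -
  let ?S = "SIGMA x : B. paths (B - {x})"
  let ?f = "\<lambda>(x, ys). x # ys"
  have inj: "inj_on ?f ?S" by (auto simp: inj_on_def)
  have eq: "paths B = insert [] (?f ` ?S)"
  proof (intro equalityI subsetI)
    fix xs assume "xs \<in> paths B" thus "xs \<in> insert [] (?f ` ?S)"
      by (cases xs) (auto simp: paths_def image_iff)
  qed (auto simp: paths_def)
  have finS: "finite ?S" using fin by auto
  have "sum g (paths B) = g [] + sum g (?f ` ?S)"
    unfolding eq using finS by (subst sum.insert) auto
  also have "sum g (?f ` ?S) = (\<Sum>(x, ys)\<in>?S. g (x # ys))"
    by (subst sum.reindex[OF inj]) (auto intro!: sum.cong)
  also have "\<dots> = (\<Sum>x\<in>B. \<Sum>ys\<in>paths (B - {x}). g (x # ys))"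
    by (rule sum.Sigma[symmetric]) (use fin in auto)
  finally show ?thesis .
qed

section \<open>Weights of paths\<close>

fun wt :: "(nat \<Rightarrow> nat \<Rightarrow> quat) \<Rightarrow> nat list \<Rightarrow> quat" where
  "wt F (x # y # zs) = F x y * wt F (y # zs)"
| "wt F _ = 1"

lemma wt_split: "wt F (xs @ x # ys) = wt F (xs @ [x]) * wt F (x # ys)"
  by (induction F xs rule: wt.induct) (auto simp: mult.assoc)

text \<open>Conjugation reverses the order of a product, and Hermitian symmetry turns the conjugate
  of each edge into the edge traversed backwards.\<close>

lemma wt_rev:
  assumes "\<And>x y. F y x = cnj (F x y)"
  shows "wt F (rev xs) = cnj (wt F xs)"
  using assms
proof (induction F xs rule: wt.induct)
  case (1 F x y zs)
  have "wt F (rev (x # y # zs)) = wt F (rev (y # zs)) * F y x"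
    using wt_split[of F "rev zs" y "[x]"] by simp
  also have "\<dots> = cnj (wt F (y # zs)) * cnj (F x y)" by (simp only: 1(1)[OF 1(2)] 1(2)[of y x])
  also have "\<dots> = cnj (wt F (x # y # zs))" by (simp add: cnj_mult)
  finally show ?case .
qed auto

text \<open>Expansion of the determinant on \<open>A\<close> whose row \<open>j\<close> has been
  overwritten by row \<open>i\<close> of \<open>F\<close>: \<open>ys\<close> lists the other members
  of the cycle through \<open>j\<close>, the sign is that of a cycle of length
  \<open>length ys + 1\<close>, and \<open>D\<close> supplies the determinant of the remaining
  indices. See \<open>row_det_eq_path_sum\<close>.\<close>

definition path_sum :: "(nat \<Rightarrow> nat \<Rightarrow> quat) \<Rightarrow> (nat set \<Rightarrow> quat) \<Rightarrow> nat set \<Rightarrow> nat \<Rightarrow> nat \<Rightarrow> quat" where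
  "path_sum F D A i j =
     (\<Sum>ys\<in>paths (A - {j}). (-1) ^ length ys * wt F (i # ys @ [j]) * D (A - {j} - set ys))"

text \<open>The determinant is kept abstract. Its ordering convention gives the expansion at the
  least index only; the locale derives the expansion at every other index from Hermitian
  symmetry.\<close>

locale hermitian_det =
  fixes F :: "nat \<Rightarrow> nat \<Rightarrow> quat" and D :: "nat set \<Rightarrow> quat"
  assumes herm: "F y x = cnj (F x y)"
    and D_empty: "D {} = 1"
    and D_Min: "finite A \<Longrightarrow> A \<noteq> {} \<Longrightarrow> D A = path_sum F D A (Min A) (Min A)"
begin

abbreviation "P \<equiv> path_sum F D"

text \<open>Contributions to the diagonal path sum at \<open>j\<close> of the cycles through \<open>j\<close> that avoid
  resp. meet \<open>m\<close>; both are visibly symmetric in \<open>j\<close> and \<open>m\<close>.\<close>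

definition avoiding :: "nat set \<Rightarrow> nat \<Rightarrow> nat \<Rightarrow> real" where
  "avoiding A j m = (\<Sum>ys\<in>paths (A - {j, m}). \<Sum>zs\<in>paths (A - {j, m} - set ys).
        (-1) ^ (length ys + length zs) * Re (wt F (j # ys @ [j])) * Re (wt F (m # zs @ [m]))
          * Re (D (A - {j, m} - set ys - set zs)))"

definition meeting :: "nat set \<Rightarrow> nat \<Rightarrow> nat \<Rightarrow> real" where
  "meeting A j m = (\<Sum>vs\<in>paths (A - {j, m}). \<Sum>us\<in>paths (A - {j, m} - set vs).
        (-1) ^ (length us + length vs) * Re (wt F (j # us @ [m]) * wt F (m # vs @ [j]))
          * Re (D (A - {j, m} - set us - set vs)))"

lemma Diff_right_commute: "X - Y - Z = X - Z - (Y :: nat set)"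
  by auto

lemma avoiding_commute: "finite A \<Longrightarrow> avoiding A j m = avoiding A m j"
  unfolding avoiding_def insert_commute[of m j]
  by (subst sum_paths_swap, simp, intro sum.cong refl)
    (simp only: Diff_right_commute[of "A - {j, m}"] add.commute mult_ac)

lemma meeting_commute: "finite A \<Longrightarrow> meeting A j m = meeting A m j"
  unfolding meeting_def insert_commute[of m j]
  by (subst sum_paths_swap, simp, intro sum.cong refl)
    (simp only: Diff_right_commute[of "A - {j, m}"] add.commute Re_mult_commute)

text \<open>The cycles through \<open>j\<close> are sorted by whether they pass through
  \<open>m\<close>. If not, the determinant of the remaining indices is expanded at
  \<open>m\<close>, giving two disjoint cycles; if so, the cycle is cut at \<open>m\<close> into two
  arcs. Real parts are taken because \<open>Re (x * y) = Re (y * x)\<close> allows such a cycle to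
  be started at \<open>m\<close> instead of \<open>j\<close>.\<close>

lemma Re_path_sum_diag:
  assumes fin: "finite A" and j: "j \<in> A" and m: "m \<in> A" and ne: "j \<noteq> m"
    and IHr: "\<And>B. B \<subset> A \<Longrightarrow> cnj (D B) = D B"
    and IHd: "\<And>B k. B \<subset> A \<Longrightarrow> k \<in> B \<Longrightarrow> P B k k = D B"
  shows "Re (P A j j) = avoiding A j m - meeting A j m"
proof -
  let ?B = "A - {j, m}"
  have DR: "D B = of_real (Re (D B))" if "B \<subset> A" for B
    using IHr[OF that] by (simp add: self_cnj_iff)
  have 1: "(\<Sum>ys\<in>paths ?B. Re ((-1) ^ length ys * wt F (j # ys @ [j]) * D (A - {j} - set ys)))
     = (\<Sum>ys\<in>paths ?B. \<Sum>zs\<in>paths (?B - set ys).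
        (-1) ^ (length ys + length zs) * Re (wt F (j # ys @ [j])) * Re (wt F (m # zs @ [m]))
          * Re (D (?B - set ys - set zs)))"
  proof (rule sum.cong[OF refl])
    fix ys assume ys: "ys \<in> paths ?B"
    let ?C = "A - {j} - set ys"
    have sub: "?C \<subset> A" using j by auto
    have mC: "m \<in> ?C" using m ne ys by (auto simp: paths_def)
    have C: "?C - {m} = ?B - set ys" by auto
    have "Re (D ?C) = Re (P ?C m m)" using IHd[OF sub mC] by simp
    also have "\<dots> = (\<Sum>zs\<in>paths (?B - set ys). Re ((-1) ^ length zs * wt F (m # zs @ [m]) * D (?B - set ys - set zs)))"
      unfolding path_sum_def C by (simp add: Re_sum)
    also have "\<dots> = (\<Sum>zs\<in>paths (?B - set ys). (-1) ^ length zs * Re (wt F (m # zs @ [m])) * Re (D (?B - set ys - set zs)))"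
    proof (rule sum.cong[OF refl])
      fix zs
      have s: "?B - set ys - set zs \<subset> A" using j by auto
      show "Re ((-1) ^ length zs * wt F (m # zs @ [m]) * D (?B - set ys - set zs)) =
        (-1) ^ length zs * Re (wt F (m # zs @ [m])) * Re (D (?B - set ys - set zs))"
        by (subst DR[OF s]) simp
    qed
    finally have e: "Re (D ?C) = \<dots>" .
    have "Re ((-1) ^ length ys * wt F (j # ys @ [j]) * D ?C) = (-1) ^ length ys * Re (wt F (j # ys @ [j])) * Re (D ?C)"
      by (subst DR[OF sub]) simp
    thus "Re ((-1) ^ length ys * wt F (j # ys @ [j]) * D ?C) =
       (\<Sum>zs\<in>paths (?B - set ys).
        (-1) ^ (length ys + length zs) * Re (wt F (j # ys @ [j])) * Re (wt F (m # zs @ [m]))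
          * Re (D (?B - set ys - set zs)))"
      unfolding e by (simp add: sum_distrib_left power_add mult_ac)
  qed
  \<comment> \<open>The vertex \<open>m\<close> adds one to the length of the list, which accounts
    for the minus sign in front of the two arcs.\<close>
  have 2: "Re ((-1) ^ length (us @ m # vs) * wt F (j # (us @ m # vs) @ [j]) * D (A - {j} - set (us @ m # vs)))
     = - ((-1) ^ (length us + length vs) * Re (wt F (j # us @ [m]) * wt F (m # vs @ [j]))
          * Re (D (?B - set us - set vs)))" for us vs
  proof -
    have w: "wt F (j # (us @ m # vs) @ [j]) = wt F (j # us @ [m]) * wt F (m # vs @ [j])"
      using wt_split[of F "j # us" m "vs @ [j]"] by simp
    have s: "A - {j} - set (us @ m # vs) = ?B - set us - set vs" by auto
    have s': "?B - set us - set vs \<subset> A" using j by auto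
    show ?thesis unfolding w s
      by (subst DR[OF s']) (simp add: power_add algebra_simps)
  qed
  have B: "A - {j} - {m} = ?B" by auto
  have f: "finite (A - {j})" "m \<in> A - {j}" using fin m ne by auto
  show ?thesis
    unfolding path_sum_def Re_sum avoiding_def meeting_def
    unfolding sum_paths_split[OF f] B
    unfolding 1 2 sum_negf by (simp only: diff_conv_add_uminus)
qed

text \<open>Reality and independence of \<open>j\<close> are proved in one induction over subsets,
  since each uses the other on smaller sets. Pairing every cycle with its reversal shows that
  \<open>P A j j\<close> is real; its real part is symmetric in \<open>j\<close> and
  \<open>m\<close> by \<open>Re_path_sum_diag\<close>, so all diagonal path sums agree, in
  particular with the one at \<open>Min A\<close>.\<close>

lemma path_sum_diag_aux:
  assumes "finite A"
  shows "cnj (D A) = D A \<and> (\<forall>j\<in>A. P A j j = D A)"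
  using assms
proof (induction A rule: finite_psubset_induct)
  case (psubset A)
  have IHr: "cnj (D B) = D B" if "B \<subset> A" for B using psubset that by blast
  have IHd: "P B k k = D B" if "B \<subset> A" "k \<in> B" for B k using psubset that by blast
  have real: "cnj (P A j j) = P A j j" if j: "j \<in> A" for j
  proof -
    have "cnj (P A j j) = (\<Sum>ys\<in>paths (A - {j}). (-1) ^ length (rev ys) * wt F (j # rev ys @ [j]) * D (A - {j} - set (rev ys)))"
      unfolding path_sum_def cnj_sum
    proof (rule sum.cong[OF refl])
      fix ys
      have s: "A - {j} - set ys \<subset> A" using j by auto
      have w: "wt F (j # rev ys @ [j]) = cnj (wt F (j # ys @ [j]))"
        using wt_rev[of F "j # ys @ [j]", OF herm] by simp
      have "cnj (D (A - {j} - set ys)) = D (A - {j} - set ys)" by (rule IHr[OF s])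
      then obtain a where a: "D (A - {j} - set ys) = of_real a" unfolding self_cnj_iff by blast
      show "cnj ((-1) ^ length ys * wt F (j # ys @ [j]) * D (A - {j} - set ys)) =
         (-1) ^ length (rev ys) * wt F (j # rev ys @ [j]) * D (A - {j} - set (rev ys))"
        unfolding w set_rev length_rev a by (simp add: quat_eq_iff)
    qed
    also have "\<dots> = P A j j" unfolding path_sum_def by (rule sum_paths_rev)
    finally show ?thesis .
  qed
  have eq: "P A j j = P A m m" if jm: "j \<in> A" "m \<in> A" for j m
  proof (cases "j = m")
    case False
    have "Re (P A j j) = avoiding A j m - meeting A j m"
      by (rule Re_path_sum_diag[OF psubset(1) jm False IHr IHd])
    also have "\<dots> = avoiding A m j - meeting A m j"
      using psubset(1) by (simp only: avoiding_commute[of A j m] meeting_commute[of A j m])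
    also have "\<dots> = Re (P A m m)"
      by (rule Re_path_sum_diag[OF psubset(1) jm(2,1) False[symmetric] IHr IHd, symmetric])
    finally have "Re (P A j j) = Re (P A m m)" .
    thus ?thesis using real[OF jm(1)] real[OF jm(2)] by (metis self_cnj_iff)
  qed simp
  show ?case
  proof (cases "A = {}")
    case False
    have "D A = P A (Min A) (Min A)" using D_Min psubset(1) False by blast
    moreover have "Min A \<in> A" using psubset(1) False by simp
    ultimately show ?thesis using real eq by metis
  qed (simp add: D_empty)
qed

lemma cnj_D: "finite A \<Longrightarrow> cnj (D A) = D A" using path_sum_diag_aux by blast

lemma path_sum_diag: "finite A \<Longrightarrow> j \<in> A \<Longrightarrow> P A j j = D A" using path_sum_diag_aux by blast

lemma D_real: "finite A \<Longrightarrow> D A = of_real (Re (D A))"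
  using cnj_D by (simp add: self_cnj_iff)

text \<open>Quaternionic form of the vanishing of a determinant with two equal rows. A path from
  \<open>i\<close> to \<open>j\<close> may return to \<open>i\<close>. For a fixed final portion
  \<open>vs\<close>, the initial loops at \<open>i\<close> sum to the diagonal path sum at
  \<open>i\<close>, that is to \<open>D (A - {j} - set vs)\<close>, with the opposite sign, and so
  cancel the path \<open>vs\<close> that never returns.\<close>

lemma path_sum_offdiag:
  assumes fin: "finite A" and i: "i \<in> A" and j: "j \<in> A" and ne: "i \<noteq> j"
  shows "P A i j = 0"
proof -
  let ?B = "A - {j} - {i}"
  have "(\<Sum>us\<in>paths (?B - set vs). (-1) ^ length (us @ i # vs) * wt F (i # (us @ i # vs) @ [j]) * D (A - {j} - set (us @ i # vs)))
     = - ((-1) ^ length vs * wt F (i # vs @ [j]) * D (A - {j} - set vs))" (is "?L = _")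
    if vs: "vs \<in> paths ?B" for vs
  proof -
    let ?C = "A - {j} - set vs"
    have fC: "finite ?C" and iC: "i \<in> ?C" using fin i ne vs by (auto simp: paths_def)
    have C: "?C - {i} = ?B - set vs" by auto
    have "?L = (\<Sum>us\<in>paths (?B - set vs). - ((-1) ^ length us * wt F (i # us @ [i]) * D (?B - set vs - set us) * ((-1) ^ length vs * wt F (i # vs @ [j]))))"
    proof (rule sum.cong[OF refl])
      fix us
      have w: "wt F (i # (us @ i # vs) @ [j]) = wt F (i # us @ [i]) * wt F (i # vs @ [j])"
        using wt_split[of F "i # us" i "vs @ [j]"] by simp
      have s: "A - {j} - set (us @ i # vs) = ?B - set vs - set us" by auto
      have "finite (?B - set vs - set us)" using fin by auto
      then obtain a where a: "D (?B - set vs - set us) = of_real a" using D_real by blast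
      show "(-1) ^ length (us @ i # vs) * wt F (i # (us @ i # vs) @ [j]) * D (A - {j} - set (us @ i # vs))
        = - ((-1) ^ length us * wt F (i # us @ [i]) * D (?B - set vs - set us) * ((-1) ^ length vs * wt F (i # vs @ [j])))"
        unfolding w s a by (simp add: quat_eq_iff power_add algebra_simps)
    qed
    also have "\<dots> = - (P ?C i i * ((-1) ^ length vs * wt F (i # vs @ [j])))"
      unfolding path_sum_def C by (simp add: sum_negf sum_distrib_right)
    also have "P ?C i i = D ?C" by (rule path_sum_diag[OF fC iC])
    also have "D ?C * ((-1) ^ length vs * wt F (i # vs @ [j])) = (-1) ^ length vs * wt F (i # vs @ [j]) * D ?C"
      by (subst (1 2) D_real[OF fC]) (rule quat_real_commute)
    finally show ?thesis .
  qed
  thus ?thesis unfolding path_sum_def using fin i ne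
    by (subst sum_paths_split[of _ i]) (simp_all add: sum_negf)
qed

end

section \<open>Cycles and row determinants\<close>

text \<open>The equation with \<open>rotate1\<close> states the successor condition at all
  positions, the wrap-around included, so that cycles can be transported through \<open>map\<close>
  and \<open>rev\<close> by list identities.\<close>

definition is_cycle :: "(nat \<Rightarrow> nat) \<Rightarrow> nat list \<Rightarrow> bool" where
  "is_cycle s xs \<longleftrightarrow> xs \<noteq> [] \<and> distinct xs \<and> map s xs = rotate1 xs"

lemma is_cycle_funpow:
  assumes "is_cycle s xs"
  shows "(s ^^ k) (hd xs) = xs ! (k mod length xs)"
proof (induction k)
  case 0 thus ?case using assms by (simp add: is_cycle_def hd_conv_nth)
next
  case (Suc k)
  let ?n = "length xs"
  have n: "?n > 0" and m: "map s xs = rotate1 xs" using assms by (auto simp: is_cycle_def)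
  have "s (xs ! (k mod ?n)) = map s xs ! (k mod ?n)" using n by simp
  also have "\<dots> = xs ! (Suc k mod ?n)" unfolding m using n by (simp add: nth_rotate1 mod_Suc_eq)
  finally show ?case using Suc by simp
qed

text \<open>Allows a cycle to be computed by exhibiting a candidate list, without returning to the
  least period in \<open>orb_len\<close>.\<close>

lemma cyc_eqI:
  assumes c: "is_cycle s xs"
  shows "cyc s (hd xs) = xs"
proof -
  have n: "length xs > 0" and d: "distinct xs" using c by (auto simp: is_cycle_def)
  have "orb_len s (hd xs) = length xs"
    unfolding orb_len_def
  proof (rule Least_equality)
    show "0 < length xs \<and> (s ^^ length xs) (hd xs) = hd xs"
      using n is_cycle_funpow[OF c, of "length xs"] by (simp add: hd_conv_nth)
    fix k assume k: "0 < k \<and> (s ^^ k) (hd xs) = hd xs"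
    show "length xs \<le> k"
    proof (rule ccontr)
      assume "\<not> length xs \<le> k"
      hence "xs ! k = xs ! 0" using k n is_cycle_funpow[OF c, of k] by (simp add: hd_conv_nth)
      hence "k = 0" using nth_eq_iff_index_eq[OF d, of k 0] n \<open>\<not> length xs \<le> k\<close> by linarith
      thus False using k by simp
    qed
  qed
  thus ?thesis unfolding cyc_def
    by (intro nth_equalityI) (auto simp: is_cycle_funpow[OF c])
qed

lemma orb_len:
  assumes "permutation s"
  shows "0 < orb_len s x \<and> (s ^^ orb_len s x) x = x"
proof -
  obtain n where "0 < n" "(s ^^ n) x = x" using permutation_self[OF assms, of x] by metis
  thus ?thesis unfolding orb_len_def by (intro LeastI[of "\<lambda>k. 0 < k \<and> (s ^^ k) x = x" n]) auto
qed

lemma is_cycle_cyc: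
  assumes p: "permutation s"
  shows "is_cycle s (cyc s x)"
proof -
  let ?n = "orb_len s x"
  have n: "0 < ?n" "(s ^^ ?n) x = x" using orb_len[OF p] by auto
  have inj: "inj s" using p by (simp add: permutation_bijective bij_is_inj)
  have "distinct (cyc s x)"
  proof -
    \<comment> \<open>By injectivity a repetition at times \<open>i < j\<close> would be a return to
      \<open>x\<close> after \<open>j - i\<close> steps, earlier than the least period.\<close>
    have "i = j" if "i \<le> j" "j < ?n" "(s ^^ i) x = (s ^^ j) x" for i j
    proof (rule ccontr)
      assume "i \<noteq> j"
      have "(s ^^ i) x = (s ^^ i) ((s ^^ (j - i)) x)"
        using that by (metis add_diff_inverse_nat funpow_add le_imp_less_Suc not_less_eq o_apply)
      hence e: "(s ^^ (j - i)) x = x" using inj_fn[OF inj, of i] by (simp add: inj_def)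
      have "\<not> (0 < j - i \<and> (s ^^ (j - i)) x = x)"
        by (rule not_less_Least) (use that \<open>i \<noteq> j\<close> in \<open>simp flip: orb_len_def\<close>)
      thus False using e that \<open>i \<noteq> j\<close> by simp
    qed
    hence "inj_on (\<lambda>k. (s ^^ k) x) {0..<?n}"
      by (intro inj_onI) (metis atLeastLessThan_iff linear)
    thus ?thesis by (simp add: cyc_def distinct_map)
  qed
  moreover have "map s (cyc s x) = rotate1 (cyc s x)"
  proof (rule nth_equalityI)
    fix i assume "i < length (map s (cyc s x))"
    hence i: "i < ?n" by (simp add: cyc_def)
    have "rotate1 (cyc s x) ! i = cyc s x ! (Suc i mod ?n)"
      using i by (simp add: nth_rotate1 cyc_def)
    also have "\<dots> = s ((s ^^ i) x)"
    proof (cases "Suc i = ?n")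
      case True
      hence "s ((s ^^ i) x) = x" using n(2) by (metis funpow.simps(2) o_apply)
      thus ?thesis using True n by (simp add: cyc_def)
    qed (use i in \<open>simp add: cyc_def\<close>)
    finally show "map s (cyc s x) ! i = rotate1 (cyc s x) ! i" using i by (simp add: cyc_def)
  qed (simp add: cyc_def)
  ultimately show ?thesis using n by (simp add: is_cycle_def cyc_def)
qed

lemma hd_cyc: "permutation s \<Longrightarrow> hd (cyc s x) = x"
  using orb_len[of s x] by (simp add: cyc_def hd_map)

lemma cyc_Cons: "permutation s \<Longrightarrow> cyc s x = x # tl (cyc s x)"
  using is_cycle_cyc[of s x] hd_cyc[of s x] by (metis is_cycle_def list.collapse)

lemma set_cyc:
  assumes p: "permutation s"
  shows "set (cyc s x) = {(s ^^ k) x | k. True}"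
proof -
  have "(s ^^ k) x \<in> set (cyc s x)" for k
  proof -
    have c: "is_cycle s (cyc s x)" by (rule is_cycle_cyc[OF p])
    have "length (cyc s x) > 0" using c by (simp add: is_cycle_def)
    thus ?thesis using is_cycle_funpow[OF c, of k] by (simp add: hd_cyc[OF p])
  qed
  thus ?thesis by (auto simp: cyc_def)
qed

lemma set_cyc_orbit: "permutation s \<Longrightarrow> set (cyc s x) = orbit s x"
  by (simp add: set_cyc orbit_altdef_permutation)

lemma leader_iff:
  "permutation s \<Longrightarrow> (\<forall>k. m \<le> (s ^^ k) m) \<longleftrightarrow> (\<forall>y\<in>set (cyc s m). m \<le> y)"
  by (auto simp: set_cyc)

lemma cyc_disjoint:
  assumes "permutation s" "m \<notin> set (cyc s j)"
  shows "set (cyc s m) \<inter> set (cyc s j) = {}"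
  using assms unfolding set_cyc_orbit[OF assms(1)]
  by (metis disjoint_iff orbit_swap orbit_trans permutation_self_in_orbit)

lemma set_cyc_subset:
  assumes "s permutes A" "x \<in> A" "finite A"
  shows "set (cyc s x) \<subseteq> A"
proof -
  have "(s ^^ k) x \<in> A" for k
    by (induction k) (use assms in \<open>auto simp: permutes_in_image\<close>)
  thus ?thesis using set_cyc[OF permutes_imp_permutation[OF assms(3,1)]] by auto
qed

lemma cyc_cong:
  assumes p: "permutation s" and eq: "\<And>y. y \<in> set (cyc s x) \<Longrightarrow> t y = s y"
  shows "cyc t x = cyc s x"
proof -
  have "is_cycle t (cyc s x)"
    using is_cycle_cyc[OF p, of x] eq by (simp add: is_cycle_def cong: map_cong)
  from cyc_eqI[OF this] show ?thesis by (simp add: hd_cyc[OF p])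
qed

section \<open>Row determinants on index sets that are not relabelled\<close>

definition leaders :: "nat set \<Rightarrow> (nat \<Rightarrow> nat) \<Rightarrow> nat \<Rightarrow> nat list" where
  "leaders A s j = sorted_list_of_set {m \<in> A. m \<notin> set (cyc s j) \<and> (\<forall>k. m \<le> (s ^^ k) m)}"

definition det_mono :: "(nat \<Rightarrow> nat \<Rightarrow> quat) \<Rightarrow> (nat \<Rightarrow> nat) \<Rightarrow> nat list \<Rightarrow> quat" where
  "det_mono G s xs = prod_list (map (\<lambda>x. G x (s x)) xs)"

text \<open>Row determinant along row \<open>j\<close> of the principal submatrix of \<open>G\<close> indexed by \<open>A\<close>,
  with row \<open>j\<close> replaced by \<open>b\<close>; the index set is not relabelled.\<close>

definition row_det :: "(nat \<Rightarrow> nat \<Rightarrow> quat) \<Rightarrow> nat set \<Rightarrow> nat \<Rightarrow> (nat \<Rightarrow> quat) \<Rightarrow> quat" where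
  "row_det G A j b = (\<Sum>s | s permutes A. of_int (sign s) *
     (b (s j) * det_mono G s (tl (cyc s j) @ concat (map (cyc s) (leaders A s j)))))"

text \<open>Every cycle starts at its least element, and the cycles come in increasing order of
  these. No distinguished row is chosen, so the empty set is covered as well;
  \<open>row_det_Min\<close> relates this to row determinants.\<close>

definition set_det :: "(nat \<Rightarrow> nat \<Rightarrow> quat) \<Rightarrow> nat set \<Rightarrow> quat" where
  "set_det G A = (\<Sum>s | s permutes A. of_int (sign s) *
     det_mono G s (concat (map (cyc s) (sorted_list_of_set {m \<in> A. \<forall>k. m \<le> (s ^^ k) m}))))"

lemma set_det_empty: "set_det G {} = 1"
  by (simp add: set_det_def det_mono_def)

text \<open>The cycle through \<open>Min A\<close> is led by \<open>Min A\<close> and comes first in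
  the sorted list of leaders. Another leader on that cycle would be at most \<open>Min A\<close>,
  hence equal to it.\<close>

lemma row_det_Min:
  assumes fin: "finite A" and ne: "A \<noteq> {}"
  shows "row_det G A (Min A) (G (Min A)) = set_det G A"
  unfolding row_det_def set_det_def
proof (rule sum.cong[OF refl], clarify)
  fix s assume s: "s permutes A"
  let ?j = "Min A" and ?L = "{m \<in> A. \<forall>k. m \<le> (s ^^ k) m}"
  have p: "permutation s" using s fin by (rule permutes_imp_permutation[rotated])
  have jA: "?j \<in> A" using fin ne by simp
  have j: "?j \<in> ?L"
    using set_cyc_subset[OF s jA fin] fin jA by (auto simp: leader_iff[OF p])
  have M: "Min ?L = ?j" using j fin by (intro Min_eqI) auto
  have "m \<notin> set (cyc s ?j)" if m: "m \<in> ?L - {?j}" for m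
  proof
    assume "m \<in> set (cyc s ?j)"
    hence "?j \<in> set (cyc s m)" unfolding set_cyc_orbit[OF p]
      by (metis orbit_swap p permutation_self_in_orbit)
    hence "m \<le> ?j" using m by (auto simp: leader_iff[OF p])
    moreover have "?j \<le> m" using m fin by simp
    ultimately show False using m by simp
  qed
  moreover have "?j \<in> set (cyc s ?j)" using cyc_Cons[OF p, of ?j] by (metis list.set_intros(1))
  ultimately have e: "?L - {?j} = {m \<in> A. m \<notin> set (cyc s ?j) \<and> (\<forall>k. m \<le> (s ^^ k) m)}" by blast
  have L: "sorted_list_of_set ?L = ?j # leaders A s ?j"
    using sorted_list_of_set_nonempty[of ?L] j fin unfolding M e leaders_def by auto
  obtain ys where ys: "cyc s ?j = ?j # ys" using cyc_Cons[OF p] by blast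
  show "of_int (sign s) * (G ?j (s ?j) * det_mono G s (tl (cyc s ?j) @ concat (map (cyc s) (leaders A s ?j)))) =
      of_int (sign s) * det_mono G s (concat (map (cyc s) (sorted_list_of_set ?L)))"
    unfolding L by (simp add: ys det_mono_def mult.assoc)
qed

text \<open>The step that shortens the cycle through \<open>j\<close>: \<open>t\<close> fixes
  \<open>s j\<close>, sends \<open>j\<close> directly to \<open>s (s j)\<close> and agrees with
  \<open>s\<close> elsewhere. Hence the other cycles and their leaders are untouched, and the
  transposition flips the sign.\<close>

lemma contract_cycle:
  assumes fin: "finite A" and s: "s permutes A" and j: "j \<in> A" and ne: "s j \<noteq> j"
  defines "t \<equiv> s \<circ> transpose j (s j)"
  shows "t permutes A - {s j}" "cyc s j = j # s j # tl (cyc t j)"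
    "leaders A s j = leaders (A - {s j}) t j"
    "\<And>m. m \<in> set (leaders A s j) \<Longrightarrow> cyc s m = cyc t m"
    "\<And>y. y \<notin> {j, s j} \<Longrightarrow> t y = s y" "t j = s (s j)" "sign t = - sign s"
proof -
  let ?x = "s j"
  have xA: "?x \<in> A" using s j by (simp add: permutes_in_image)
  have tA: "t permutes A" unfolding t_def
    using permutes_compose[OF permutes_swap_id[OF j xA] s] by simp
  show tp: "t permutes A - {?x}"
    by (rule permutes_superset[OF tA]) (auto simp: t_def)
  have p: "permutation s" using permutes_imp_permutation[OF fin s] .
  have pt: "permutation t" using permutes_imp_permutation[OF fin tA] .
  show ty: "\<And>y. y \<notin> {j, ?x} \<Longrightarrow> t y = s y" by (auto simp: t_def transpose_def)
  show tj: "t j = s ?x" by (simp add: t_def)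
  show "sign t = - sign s" unfolding t_def
    using sign_compose[OF p permutation_swap_id] ne by (simp add: sign_swap_id)
  have sub: "set (cyc t j) \<subseteq> A - {?x}" using set_cyc_subset[OF tp] j ne fin by auto
  obtain ys where ys: "cyc t j = j # ys" using cyc_Cons[OF pt] by blast
  have cyc: "is_cycle t (j # ys)" using is_cycle_cyc[OF pt, of j] by (simp add: ys)
  have m: "map s ys = map t ys"
    by (rule map_cong) (use sub cyc ys in \<open>auto simp: is_cycle_def intro!: ty[symmetric]\<close>)
  have "is_cycle s (j # ?x # ys)"
    using cyc sub ne by (auto simp: is_cycle_def ys tj m simp del: map_eq_conv)
  from cyc_eqI[OF this] show cs: "cyc s j = j # ?x # tl (cyc t j)" by (simp add: ys)
  have out: "cyc t m = cyc s m" if "m \<notin> set (cyc s j)" for m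
  proof (rule cyc_cong[OF p])
    fix y assume "y \<in> set (cyc s m)"
    hence "y \<notin> set (cyc s j)" using cyc_disjoint[OF p that] by auto
    thus "t y = s y" by (intro ty) (auto simp: cs)
  qed
  have "{m \<in> A. m \<notin> set (cyc s j) \<and> (\<forall>k. m \<le> (s ^^ k) m)} =
        {m \<in> A - {?x}. m \<notin> set (cyc t j) \<and> (\<forall>k. m \<le> (t ^^ k) m)}"
  proof (rule Collect_cong)
    fix m
    show "(m \<in> A \<and> m \<notin> set (cyc s j) \<and> (\<forall>k. m \<le> (s ^^ k) m)) \<longleftrightarrow>
        (m \<in> A - {?x} \<and> m \<notin> set (cyc t j) \<and> (\<forall>k. m \<le> (t ^^ k) m))"
      unfolding leader_iff[OF p] leader_iff[OF pt]
      by (cases "m \<in> set (cyc s j)") (use out in \<open>auto simp: cs ys\<close>)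
  qed
  thus L: "leaders A s j = leaders (A - {?x}) t j" by (simp add: leaders_def)
  show "\<And>m. m \<in> set (leaders A s j) \<Longrightarrow> cyc s m = cyc t m"
    using out fin by (auto simp: leaders_def)
qed

lemma set_leaders_cyc:
  assumes fin: "finite A" and s: "s permutes A"
  shows "set (concat (map (cyc s) (leaders A s j))) \<subseteq> A - set (cyc s j)"
proof -
  have p: "permutation s" using permutes_imp_permutation[OF fin s] .
  show ?thesis using set_cyc_subset[OF s _ fin] cyc_disjoint[OF p] fin
    by (fastforce simp: leaders_def)
qed

lemma det_mono_cong:
  "(\<And>y. y \<in> set xs \<Longrightarrow> G y (s y) = H y (t y)) \<Longrightarrow> det_mono G s xs = det_mono H t xs"
  unfolding det_mono_def by (metis (mono_tags, lifting) map_eq_conv)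

text \<open>With the leading factor \<open>b (s j)\<close> split off, the next factor lies in row
  \<open>s j\<close>. It takes over the role of the replaced row \<open>j\<close> in the monomial of
  the contracted permutation, and the order of the factors is preserved.\<close>

lemma row_det_term_contract:
  assumes fin: "finite A" and s: "s permutes A" and j: "j \<in> A" and ne: "s j \<noteq> j"
  defines "t \<equiv> s \<circ> transpose j (s j)"
  shows "of_int (sign s) * (b (s j) * det_mono G s (tl (cyc s j) @ concat (map (cyc s) (leaders A s j))))
   = - (b (s j) * (of_int (sign t) * (G (s j) (t j) *
       det_mono G t (tl (cyc t j) @ concat (map (cyc t) (leaders (A - {s j}) t j))))))"
proof -
  note c = contract_cycle[OF fin s j ne, folded t_def]
  let ?xs = "tl (cyc t j) @ concat (map (cyc t) (leaders (A - {s j}) t j))"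
  have finx: "finite (A - {s j})" using fin by simp
  have pt: "permutation t" using permutes_imp_permutation[OF finx c(1)] .
  have "map (cyc s) (leaders A s j) = map (cyc t) (leaders (A - {s j}) t j)"
    using c(3,4) by simp
  hence e: "tl (cyc s j) @ concat (map (cyc s) (leaders A s j)) = s j # ?xs"
    by (simp add: c(2))
  have 1: "set (cyc t j) \<subseteq> A - {s j}" using set_cyc_subset[OF c(1) _ finx] j ne by auto
  have 2: "j \<notin> set (tl (cyc t j))" using is_cycle_cyc[OF pt, of j] cyc_Cons[OF pt, of j]
    unfolding is_cycle_def by (metis distinct.simps(2))
  have 4: "j \<in> set (cyc t j)" using cyc_Cons[OF pt, of j] by (metis list.set_intros(1))
  have 3: "set (concat (map (cyc t) (leaders (A - {s j}) t j))) \<subseteq> A - {s j} - {j}"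
    using set_leaders_cyc[OF finx c(1), of j] 4 by blast
  have "set ?xs \<inter> {j, s j} = {}" using 1 2 3 cyc_Cons[OF pt, of j]
    by (auto dest: list.set_sel(2)) (metis Diff_iff insert_iff list.set_intros(2) subsetD)+
  hence "det_mono G s ?xs = det_mono G t ?xs"
    by (intro det_mono_cong) (metis c(5) disjoint_iff)
  moreover have "sign s = - sign t" using c(7) by simp
  ultimately show ?thesis unfolding e c(6)
    by (simp add: det_mono_def mult.assoc) (rule sign_cases[of t]; simp)
qed

text \<open>Permutations are grouped by \<open>x = s j\<close>. For \<open>x = j\<close> the cycle
  is a fixed point and the other cycles form \<open>set_det\<close>; for \<open>x\<close> distinct
  from \<open>j\<close>, composing with the transposition of \<open>j\<close> and \<open>x\<close>
  is a bijection onto the permutations of \<open>A - {x}\<close>, and each term is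
  contracted.\<close>

lemma row_det_rec:
  assumes fin: "finite A" and j: "j \<in> A"
  shows "row_det G A j b = b j * set_det G (A - {j})
    - (\<Sum>x\<in>A - {j}. b x * row_det G (A - {x}) j (G x))"
proof -
  let ?T = "\<lambda>s. of_int (sign s) *
     (b (s j) * det_mono G s (tl (cyc s j) @ concat (map (cyc s) (leaders A s j))))"
  let ?U = "\<lambda>x t. of_int (sign t) * (G x (t j) *
       det_mono G t (tl (cyc t j) @ concat (map (cyc t) (leaders (A - {x}) t j))))"
  have fp: "finite {s. s permutes A}" using fin by (rule finite_permutations)
  have "row_det G A j b = (\<Sum>x\<in>A. \<Sum>s | s permutes A \<and> s j = x. ?T s)"
    unfolding row_det_def
    by (subst sum.group[OF fp fin, of "\<lambda>s. s j", symmetric])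
      (use j in \<open>auto simp: permutes_in_image\<close>)
  also have "\<dots> = (\<Sum>s | s permutes A \<and> s j = j. ?T s) + (\<Sum>x\<in>A-{j}. \<Sum>s | s permutes A \<and> s j = x. ?T s)"
    by (rule sum.remove[OF fin j])
  also have "(\<Sum>s | s permutes A \<and> s j = j. ?T s) = b j * set_det G (A - {j})"
  proof -
    have e: "{s. s permutes A \<and> s j = j} = {s. s permutes (A - {j})}"
      by (auto intro: permutes_superset permutes_subset dest: permutes_not_in)
    have "?T s = b j * (of_int (sign s) * det_mono G s (concat (map (cyc s)
        (sorted_list_of_set {m \<in> A - {j}. \<forall>k. m \<le> (s ^^ k) m}))))" if s: "s permutes (A - {j})" for s
    proof -
      have sj: "s j = j" using s by (simp add: permutes_not_in)
      have "is_cycle s [j]" using sj by (simp add: is_cycle_def)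
      from cyc_eqI[OF this] have "cyc s j = [j]" by simp
      thus ?thesis by (simp add: sj leaders_def mult.assoc[symmetric])
        (rule sign_cases[of s]; simp add: conj_commute conj_left_commute Diff_eq conj_assoc)
    qed
    thus ?thesis unfolding e set_det_def by (simp add: sum_distrib_left)
  qed
  also have "(\<Sum>x\<in>A-{j}. \<Sum>s | s permutes A \<and> s j = x. ?T s) = (\<Sum>x\<in>A-{j}. - (b x * row_det G (A - {x}) j (G x)))"
  proof (rule sum.cong[OF refl])
    fix x assume x: "x \<in> A - {j}"
    have "(\<Sum>s | s permutes A \<and> s j = x. ?T s) = (\<Sum>t | t permutes A - {x}. - (b x * ?U x t))"
    proof (rule sum.reindex_bij_witness[where i = "\<lambda>t. t \<circ> transpose j x" and j = "\<lambda>s. s \<circ> transpose j x"])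
      fix s assume "s \<in> {s. s permutes A \<and> s j = x}"
      hence s: "s permutes A" "s j = x" by auto
      show "s \<circ> transpose j x \<circ> transpose j x = s" by (simp add: comp_assoc)
      show "s \<circ> transpose j x \<in> {t. t permutes A - {x}}"
        using contract_cycle(1)[OF fin s(1) j] s x by auto
      show "- (b x * ?U x (s \<circ> transpose j x)) = ?T s"
        using row_det_term_contract[OF fin s(1) j, of b G] s x by simp
    next
      fix t assume "t \<in> {t. t permutes A - {x}}"
      hence t: "t permutes A - {x}" by simp
      show "t \<circ> transpose j x \<circ> transpose j x = t" by (simp add: comp_assoc)
      have "t permutes A" using t by (rule permutes_subset) auto
      hence "t \<circ> transpose j x permutes A"
        by (intro permutes_compose[of "transpose j x" A t] permutes_swap_id) (use j x in auto)
      thus "t \<circ> transpose j x \<in> {s. s permutes A \<and> s j = x}"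
        using t by (simp add: permutes_not_in)
    qed
    thus "(\<Sum>s | s permutes A \<and> s j = x. ?T s) = - (b x * row_det G (A - {x}) j (G x))"
      by (simp add: row_det_def sum_negf sum_distrib_left)
  qed
  finally show ?thesis by (simp add: sum_negf)
qed

text \<open>Iterating \<open>row_det_rec\<close> spells out the cycle through \<open>j\<close> one
  vertex at a time. The start \<open>i\<close> is left arbitrary in the induction because each step
  moves it to the next vertex \<open>x\<close>.\<close>

lemma row_det_eq_path_sum:
  assumes "finite A" "j \<in> A"
  shows "row_det G A j (G i) = path_sum G (set_det G) A i j"
  using assms
proof (induction "card A" arbitrary: A i rule: less_induct)
  case less
  have f: "finite (A - {j})" using less by simp
  have "path_sum G (set_det G) A i j = G i j * set_det G (A - {j}) +
     (\<Sum>x\<in>A - {j}. \<Sum>ys\<in>paths (A - {j} - {x}).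
       - (G i x * ((-1) ^ length ys * wt G (x # ys @ [j]) * set_det G (A - {x} - {j} - set ys))))"
    unfolding path_sum_def sum_paths_first[OF f]
  proof (intro arg_cong2[where f = "(+)"] sum.cong refl, goal_cases)
    case (2 x ys)
    \<comment> \<open>Signs are central, so they can be moved past the quaternion weights.\<close>
    have c: "(-1) ^ n * y = y * (-1 :: quat) ^ n" for n y by (induction n) auto
    have "A - {j} - set (x # ys) = A - {x} - {j} - set ys" by auto
    thus ?case by (simp add: mult.assoc) (simp add: c mult.assoc)
  qed simp
  also have "\<dots> = G i j * set_det G (A - {j}) - (\<Sum>x\<in>A - {j}. G i x * path_sum G (set_det G) (A - {x}) x j)"
    by (simp add: path_sum_def sum_negf sum_distrib_left Diff_insert2[symmetric] insert_commute
        flip: Diff_insert)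
  also have "\<dots> = row_det G A j (G i)"
    unfolding row_det_rec[OF less(2,3)]
  proof (intro arg_cong2[where f = "(-)"] sum.cong refl)
    fix x assume x: "x \<in> A - {j}"
    have "card (A - {x}) < card A" using x less(2) by (intro card_Diff1_less) auto
    from less(1)[OF this] show "G i x * path_sum G (set_det G) (A - {x}) x j = G i x * row_det G (A - {x}) j (G x)"
      using x less by simp
  qed
  finally show ?case ..
qed

section \<open>Principal submatrices and column determinants\<close>

lemma map_permutation_apply_eq:
  "map_permutation A f p = (\<lambda>x. if x \<in> f ` A then f (p (inv_into A f x)) else x)"
  by (auto simp: map_permutation_def restrict_id_def fun_eq_iff)

lemma sorted_list_of_set_image:
  assumes fin: "finite S" and mono: "\<And>x y. x \<in> S \<Longrightarrow> y \<in> S \<Longrightarrow> x < y \<Longrightarrow> f x < (f y :: nat)"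
  shows "sorted_list_of_set (f ` S) = map f (sorted_list_of_set (S :: nat set))"
proof -
  have "sorted_wrt (<) (sorted_list_of_set S)" by simp
  hence "sorted_wrt (\<lambda>x y. f x < f y) (sorted_list_of_set S)"
    by (rule sorted_wrt_mono_rel[rotated]) (use mono fin in auto)
  hence s: "sorted_wrt (<) (map f (sorted_list_of_set S))" by (simp add: sorted_wrt_map)
  have "set (map f (sorted_list_of_set S)) = f ` S" using fin by simp
  thus ?thesis using s fin
    by (metis sorted_list_of_set.idem_if_sorted_distinct strict_sorted_iff)
qed

text \<open>Transporting permutations along \<open>\<phi>\<close> maps cycles to cycles. Since
  \<open>\<phi>\<close> is increasing, it also preserves leaders and their order, so the
  noncommutative products agree factor by factor.\<close>

lemma rdet_relabel:
  assumes bij: "bij_betw \<phi> {0..<k} A" and mono: "\<And>x y. x < y \<Longrightarrow> y < k \<Longrightarrow> \<phi> x < \<phi> y"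
    and c: "c < k" and H: "H \<in> carrier_mat k k"
    and HG: "\<And>x y. x < k \<Longrightarrow> y < k \<Longrightarrow> H $$ (x, y) = G (\<phi> x) (\<phi> y)"
  shows "rdet c H = row_det G A (\<phi> c) (G (\<phi> c))"
proof -
  let ?K = "{0..<k}"
  let ?t = "map_permutation ?K \<phi>"
  have inj: "inj_on \<phi> ?K" and im: "\<phi> ` ?K = A" using bij by (auto simp: bij_betw_def)
  have finA: "finite A" using im by auto
  have bt: "bij_betw ?t {s. s permutes ?K} {t. t permutes A}"
    using bij_betw_permutations[OF bij] unfolding map_permutation_apply_eq im .
  have Hk: "dim_row H = k" using H by simp
  have "rdet c H = (\<Sum>s | s permutes ?K. of_int (sign (?t s)) * (G (\<phi> c) (?t s (\<phi> c)) *
     det_mono G (?t s) (tl (cyc (?t s) (\<phi> c)) @ concat (map (cyc (?t s)) (leaders A (?t s) (\<phi> c))))))"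
    unfolding rdet_def Hk
  proof (rule sum.cong[OF refl], clarify)
    fix s assume s: "s permutes ?K"
    define t where "t = ?t s"
    have t: "t (\<phi> x) = \<phi> (s x)" if "x < k" for x
      using map_permutation_apply[OF inj, of x s] that by (simp add: t_def)
    have tA: "t permutes A" unfolding t_def by (rule map_permutation_permutes[OF bij s])
    have ps: "permutation s" using s permutes_imp_permutation by blast
    have pt: "permutation t" using tA finA permutes_imp_permutation by blast
    have sub: "set (cyc s x) \<subseteq> ?K" if "x < k" for x
      using set_cyc_subset[OF s] that by simp
    have cyc: "cyc t (\<phi> x) = map \<phi> (cyc s x)" if x: "x < k" for x
    proof -
      have 1: "is_cycle s (cyc s x)" by (rule is_cycle_cyc[OF ps])
      have "map t (map \<phi> (cyc s x)) = map \<phi> (map s (cyc s x))"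
        using sub[OF x] by (auto intro!: t)
      also have "\<dots> = rotate1 (map \<phi> (cyc s x))" using 1 by (simp only: is_cycle_def rotate1_map)
      finally have "is_cycle t (map \<phi> (cyc s x))"
        using 1 inj_on_subset[OF inj sub[OF x]] by (simp add: is_cycle_def distinct_map)
      from cyc_eqI[OF this] show ?thesis using 1 by (simp add: hd_map is_cycle_def hd_cyc[OF ps])
    qed
    have le: "\<phi> x \<le> \<phi> y \<longleftrightarrow> x \<le> y" if "x < k" "y < k" for x y
      using mono[of x y] mono[of y x] that by (metis le_less_linear not_less order_le_less)
    \<comment> \<open>A leader is the minimum of its cycle, and \<open>\<phi>\<close> preserves and
      reflects the order.\<close>
    have ld: "(\<forall>i. \<phi> m \<le> (t ^^ i) (\<phi> m)) \<longleftrightarrow> (\<forall>i. m \<le> (s ^^ i) m)" if m: "m < k" for m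
      unfolding leader_iff[OF pt] leader_iff[OF ps] cyc[OF m] set_map ball_simps
      by (rule ball_cong[OF refl], rule le) (use sub[OF m] m in auto)
    have mem: "\<phi> m \<in> set (cyc t (\<phi> c)) \<longleftrightarrow> m \<in> set (cyc s c)" if m: "m < k" for m
      unfolding cyc[OF c] set_map using inj_on_image_mem_iff[OF inj _ sub[OF c], of m] m by simp
    let ?L = "{m \<in> ?K. m \<notin> set (cyc s c) \<and> (\<forall>k. m \<le> (s ^^ k) m)}"
    have "{m \<in> A. m \<notin> set (cyc t (\<phi> c)) \<and> (\<forall>k. m \<le> (t ^^ k) m)} = \<phi> ` ?L"
      unfolding im[symmetric] using ld mem by auto
    hence L: "leaders A t (\<phi> c) = map \<phi> (cyc_leaders k s c)"
      unfolding leaders_def cyc_leaders_def by (simp only:) (rule sorted_list_of_set_image, auto intro: mono)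
    have Lk: "set (cyc_leaders k s c) \<subseteq> ?K" by (auto simp: cyc_leaders_def)
    have "map (cyc t) (leaders A t (\<phi> c)) = map (map \<phi>) (map (cyc s) (cyc_leaders k s c))"
      unfolding L using Lk by (auto intro!: cyc)
    hence C: "cyc t (\<phi> c) @ concat (map (cyc t) (leaders A t (\<phi> c))) = map \<phi> (rdet_seq k s c)"
      by (simp only: rdet_seq_def map_append map_concat cyc[OF c])
    have R: "set (rdet_seq k s c) \<subseteq> ?K" using sub c Lk by (fastforce simp: rdet_seq_def)
    obtain ys where ys: "cyc t (\<phi> c) = \<phi> c # ys" using cyc_Cons[OF pt] by blast
    have "G (\<phi> c) (t (\<phi> c)) * det_mono G t (tl (cyc t (\<phi> c)) @ concat (map (cyc t) (leaders A t (\<phi> c))))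
       = det_mono G t (map \<phi> (rdet_seq k s c))"
      unfolding C[symmetric] by (simp add: ys det_mono_def)
    also have "\<dots> = prod_list (map (\<lambda>x. H $$ (x, s x)) (rdet_seq k s c))"
      unfolding det_mono_def map_map
    proof (intro arg_cong[where f = prod_list] map_cong refl)
      fix x assume "x \<in> set (rdet_seq k s c)"
      hence x: "x < k" using R by auto
      hence "s x < k" using permutes_in_image[OF s, of x] by simp
      thus "((\<lambda>x. G x (t x)) \<circ> \<phi>) x = H $$ (x, s x)" using x by (simp add: t HG)
    qed
    finally show "of_int (sign s) * prod_list (map (\<lambda>x. H $$ (x, s x)) (rdet_seq k s c)) =
      of_int (sign (?t s)) * (G (\<phi> c) (?t s (\<phi> c)) *
        det_mono G (?t s) (tl (cyc (?t s) (\<phi> c)) @ concat (map (cyc (?t s)) (leaders A (?t s) (\<phi> c)))))"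
      using sign_map_permutation[OF inj s] unfolding t_def by simp
  qed
  also have "\<dots> = row_det G A (\<phi> c) (G (\<phi> c))"
    unfolding row_det_def by (rule sum.reindex_bij_betw[OF bt])
  finally show ?thesis .
qed

lemma princ_carrier:
  assumes "F \<in> carrier_mat n n" "A \<subseteq> {0..<n}"
  shows "princ F A \<in> carrier_mat (card A) (card A)"
proof -
  have "{i. i < n \<and> i \<in> A} = A" using assms(2) by auto
  thus ?thesis using assms(1) by (auto simp: princ_def submatrix_def)
qed

lemma princ_index:
  assumes "F \<in> carrier_mat n n" "A \<subseteq> {0..<n}" "x < card A" "y < card A"
  shows "princ F A $$ (x, y) = F $$ (pick A x, pick A y)"
proof -
  have "{i. i < n \<and> i \<in> A} = A" using assms(2) by auto
  thus ?thesis using assms by (auto simp: princ_def submatrix_index)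
qed

lemma bij_betw_pick:
  assumes "finite A"
  shows "bij_betw (pick A) {0..<card A} A"
proof -
  have inj: "inj_on (pick A) {0..<card A}"
    by (rule inj_onI) (metis atLeastLessThan_iff linorder_neqE_nat nat_less_le pick_mono_le)
  have "pick A ` {0..<card A} = A"
    by (rule card_subset_eq[OF assms]) (auto simp: pick_in_set_le card_image[OF inj])
  thus ?thesis using inj by (simp add: bij_betw_def)
qed

text \<open>The number of elements of \<open>A\<close> below \<open>j\<close> is the position of
  \<open>j\<close> in the increasing enumeration \<open>pick A\<close>, so
  \<open>rdet_relabel\<close> applies at that position.\<close>

lemma rdet_sub_eq_row_det:
  assumes F: "F \<in> carrier_mat n n" and A: "A \<subseteq> {0..<n}" and j: "j \<in> A"
  shows "rdet_sub j F A = row_det (\<lambda>x y. F $$ (x, y)) A j (\<lambda>y. F $$ (j, y))"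
proof -
  have fin: "finite A" using A finite_subset by blast
  have "{a \<in> A. a < j} \<subset> A" using j by auto
  hence c: "card {a \<in> A. a < j} < card A" using fin by (rule psubset_card_mono[rotated])
  show ?thesis
    unfolding rdet_sub_def
    using rdet_relabel[OF bij_betw_pick[OF fin] _ c princ_carrier[OF F A], of "\<lambda>x y. F $$ (x, y)"]
    by (simp add: princ_index[OF F A] pick_mono_le pick_card_in_set[OF j])
qed

text \<open>Row \<open>j\<close> of \<open>G\<close> is never read: the tail of the cycle through
  \<open>j\<close> and all other cycles avoid \<open>j\<close>. This is why the two matrices are
  compared only off that row.\<close>

lemma row_det_cong:
  assumes fin: "finite A" and j: "j \<in> A" and b: "\<And>y. y \<in> A \<Longrightarrow> b y = b' y"
    and G: "\<And>x y. x \<in> A - {j} \<Longrightarrow> y \<in> A \<Longrightarrow> G x y = H x y"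
  shows "row_det G A j b = row_det H A j b'"
  unfolding row_det_def
proof (rule sum.cong[OF refl], clarify)
  fix s assume s: "s permutes A"
  have p: "permutation s" using permutes_imp_permutation[OF fin s] .
  obtain ys where ys: "cyc s j = j # ys" using cyc_Cons[OF p] by blast
  have "distinct (cyc s j)" using is_cycle_cyc[OF p] by (simp add: is_cycle_def)
  hence "set (tl (cyc s j)) \<subseteq> A - {j}" using set_cyc_subset[OF s j fin] by (auto simp: ys)
  moreover have "set (concat (map (cyc s) (leaders A s j))) \<subseteq> A - {j}"
    using set_leaders_cyc[OF fin s, of j] by (auto simp: ys)
  ultimately have "det_mono G s (tl (cyc s j) @ concat (map (cyc s) (leaders A s j)))
    = det_mono H s (tl (cyc s j) @ concat (map (cyc s) (leaders A s j)))"
    by (intro det_mono_cong G) (use permutes_in_image[OF s] in auto)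
  moreover have "b (s j) = b' (s j)" using b j permutes_in_image[OF s] by simp
  ultimately show "of_int (sign s) * (b (s j) * det_mono G s (tl (cyc s j) @ concat (map (cyc s) (leaders A s j)))) =
    of_int (sign s) * (b' (s j) * det_mono H s (tl (cyc s j) @ concat (map (cyc s) (leaders A s j))))" by simp
qed

lemma rdet_sub_repl_row:
  assumes F: "F \<in> carrier_mat n n" and A: "A \<subseteq> {0..<n}" and j: "j \<in> A"
  shows "rdet_sub j (repl_row F j b) A = row_det (\<lambda>x y. F $$ (x, y)) A j (\<lambda>y. b $ y)"
proof -
  have R: "repl_row F j b \<in> carrier_mat n n" using F by (simp add: repl_row_def)
  have fin: "finite A" using A finite_subset by blast
  show ?thesis unfolding rdet_sub_eq_row_det[OF R A j]
    by (rule row_det_cong[OF fin j]) (use F A j in \<open>auto simp: repl_row_def subset_iff\<close>)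
qed

text \<open>\<open>hdet\<close> takes the row determinant at position 0 of the submatrix, which
  comes from the index \<open>Min A\<close>.\<close>

lemma hdet_princ:
  assumes F: "F \<in> carrier_mat n n" and A: "A \<subseteq> {0..<n}"
  shows "hdet (princ F A) = set_det (\<lambda>x y. F $$ (x, y)) A"
proof (cases "A = {}")
  case True
  thus ?thesis using princ_carrier[OF F A] by (simp add: hdet_def set_det_empty)
next
  case False
  have fin: "finite A" using A finite_subset by blast
  have "{a \<in> A. a < Min A} = {}" using fin False by auto
  moreover have "card A \<noteq> 0" using fin False by simp
  ultimately have "hdet (princ F A) = rdet_sub (Min A) F A"
    using princ_carrier[OF F A] by (simp only: hdet_def rdet_sub_def) simp
  thus ?thesis
    using rdet_sub_eq_row_det[OF F A] fin False row_det_Min[OF fin False] by simp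
qed

section \<open>Conjugate transposes and column determinants\<close>

lemma ctrans_carrier [simp]: "ctrans A \<in> carrier_mat m n \<longleftrightarrow> A \<in> carrier_mat n m"
  by (auto simp: ctrans_def)

lemma ctrans_dim [simp]: "dim_row (ctrans A) = dim_col A" "dim_col (ctrans A) = dim_row A"
  by (auto simp: ctrans_def)

lemma ctrans_index [simp]:
  "i < dim_col A \<Longrightarrow> j < dim_row A \<Longrightarrow> ctrans A $$ (i, j) = cnj (A $$ (j, i))"
  by (simp add: ctrans_def)

text \<open>Inverting a permutation reverses its cycles, as conjugation does with products.\<close>

lemma cdet_ctrans:
  assumes F: "F \<in> carrier_mat n n" and j: "j < n"
  shows "cdet j (ctrans F) = cnj (rdet j F)"
proof -
  have "cnj (rdet j F) = (\<Sum>s | s permutes {0..<n}.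
      of_int (sign s) * cnj (prod_list (map (\<lambda>x. F $$ (x, s x)) (rdet_seq n s j))))"
    unfolding rdet_def cnj_sum using F
    by (intro sum.cong) (auto simp: cnj_mult sign_def)
  also have "\<dots> = (\<Sum>s | s permutes {0..<n}.
      of_int (sign s) * prod_list (map (\<lambda>x. ctrans F $$ (x, s x)) (cdet_seq n s j)))"
  proof (rule sum.reindex_bij_witness[where i = "\<lambda>s. inv_into UNIV s" and j = "\<lambda>s. inv_into UNIV s"]; clarify)
    fix s assume s: "s permutes {0..<n}"
    show "inv_into UNIV (inv_into UNIV s) = s" by (rule permutes_inv_inv[OF s])
    show "inv_into UNIV s permutes {0..<n}" by (rule permutes_inv[OF s])
    have p: "permutation s" using s permutes_imp_permutation by blast
    have ip: "permutation (inv_into UNIV s)" using p by (rule permutation_inverse)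
    have inv: "inv_into UNIV s (s x) = x" for x :: nat using permutes_inverses(2)[OF s] .
    \<comment> \<open>Applying \<open>s\<close> to its cycle only rotates it, and reversing the
      rotated list puts \<open>x\<close> first, followed by the rest of the cycle backwards.\<close>
    have cy: "cyc (inv_into UNIV s) x = rev (map s (cyc s x))" for x
    proof -
      obtain ys where ys: "cyc s x = x # ys" using cyc_Cons[OF p] by blast
      have c: "distinct (x # ys)" "map s (x # ys) = ys @ [x]"
        using is_cycle_cyc[OF p, of x] by (auto simp: is_cycle_def ys)
      have "map (inv_into UNIV s) (rev (ys @ [x])) = rev (x # ys)"
        unfolding c(2)[symmetric] rev_map[symmetric] by (simp add: inv o_def)
      hence "is_cycle (inv_into UNIV s) (x # rev ys)" using c(1) by (simp add: is_cycle_def)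
      from cyc_eqI[OF this] show ?thesis by (simp only: ys c(2)) simp
    qed
    have st: "set (cyc (inv_into UNIV s) x) = set (cyc s x)" for x
    proof -
      have "map s (cyc s x) = rotate1 (cyc s x)" using is_cycle_cyc[OF p] by (simp add: is_cycle_def)
      thus ?thesis unfolding cy by simp
    qed
    \<comment> \<open>A permutation and its inverse have the same cycles as sets, hence the same
      leaders.\<close>
    have L: "cyc_leaders n (inv_into UNIV s) j = cyc_leaders n s j"
      unfolding cyc_leaders_def leader_iff[OF p] leader_iff[OF ip] st ..
    let ?f = "\<lambda>x. ctrans F $$ (x, inv_into UNIV s x)"
    have m: "map ?f (cyc (inv_into UNIV s) x) = rev (map cnj (map (\<lambda>x. F $$ (x, s x)) (cyc s x)))" if x: "x < n" for x
    proof -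
      have "y < n \<and> s y < n" if "y \<in> set (cyc s x)" for y
        using set_cyc_subset[OF s, of x] x that permutes_in_image[OF s, of y] by auto
      thus ?thesis unfolding cy rev_map[symmetric] map_map using F
        by (intro arg_cong[where f = rev] map_cong) (auto simp: inv)
    qed
    have "map ?f (cdet_seq n (inv_into UNIV s) j) = rev (map cnj (map (\<lambda>x. F $$ (x, s x)) (rdet_seq n s j)))"
    proof -
      have "map (map ?f) (map (cyc (inv_into UNIV s)) (rev (cyc_leaders n s j))) =
        map rev (rev (map (map cnj) (map (map (\<lambda>x. F $$ (x, s x))) (map (cyc s) (cyc_leaders n s j)))))"
        unfolding rev_map map_map by (intro map_cong refl) (auto simp: cyc_leaders_def m[unfolded map_map o_def] o_def)
      thus ?thesis
        by (simp only: cdet_seq_def rdet_seq_def L map_append map_concat rev_append rev_concat m[OF j])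
    qed
    thus "of_int (sign (inv_into UNIV s)) * prod_list (map ?f (cdet_seq n (inv_into UNIV s) j)) =
       of_int (sign s) * cnj (prod_list (map (\<lambda>x. F $$ (x, s x)) (rdet_seq n s j)))"
      by (simp add: cnj_prod_list sign_inverse[OF p])
  qed (rule permutes_inv_inv permutes_inv; assumption)+
  also have "\<dots> = cdet j (ctrans F)" using F by (simp add: cdet_def)
  finally show ?thesis ..
qed

lemma princ_ctrans:
  assumes "F \<in> carrier_mat n n" "A \<subseteq> {0..<n}"
  shows "princ (ctrans F) A = ctrans (princ F A)"
proof (rule eq_matI)
  have c: "ctrans F \<in> carrier_mat n n" using assms by simp
  note d = princ_carrier[OF assms] princ_carrier[OF c assms(2)]
  show "dim_row (princ (ctrans F) A) = dim_row (ctrans (princ F A))"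
    "dim_col (princ (ctrans F) A) = dim_col (ctrans (princ F A))" using d by auto
  fix x y assume "x < dim_row (ctrans (princ F A))" "y < dim_col (ctrans (princ F A))"
  hence xy: "x < card A" "y < card A" using d by auto
  have "pick A x < n" "pick A y < n" using pick_in_set_le[OF xy(1)] pick_in_set_le[OF xy(2)] assms(2) by auto
  thus "princ (ctrans F) A $$ (x, y) = ctrans (princ F A) $$ (x, y)"
    using xy d assms by (simp add: princ_index[OF c assms(2)] princ_index[OF assms])
qed

lemma cdet_sub_ctrans:
  assumes F: "F \<in> carrier_mat n n" and A: "A \<subseteq> {0..<n}" and j: "j \<in> A"
  shows "cdet_sub j (ctrans F) A = cnj (rdet_sub j F A)"
proof -
  have fin: "finite A" using A finite_subset by blast
  have "{a \<in> A. a < j} \<subset> A" using j by auto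
  hence c: "card {a \<in> A. a < j} < card A" using fin by (rule psubset_card_mono[rotated])
  show ?thesis unfolding cdet_sub_def rdet_sub_def princ_ctrans[OF F A]
    by (rule cdet_ctrans[OF princ_carrier[OF F A] c])
qed

text \<open>For Hermitian \<open>F\<close>, replacing column \<open>j\<close> by \<open>b\<close> is
  adjoint to replacing row \<open>j\<close> by the conjugate of \<open>b\<close>; then
  \<open>cdet_sub_ctrans\<close> applies.\<close>

lemma cdet_sub_repl_col:
  assumes F: "F \<in> carrier_mat n n" and herm: "ctrans F = F" and A: "A \<subseteq> {0..<n}" and j: "j \<in> A"
    and b: "dim_vec b = n"
  shows "cdet_sub j (repl_col F j b) A = cnj (rdet_sub j (repl_row F j (map_vec cnj b)) A)"
proof -
  have h: "F $$ (k, l) = cnj (F $$ (l, k))" if "k < n" "l < n" for k l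
    using ctrans_index[of k F l] that F by (simp add: herm)
  have "repl_col F j b = ctrans (repl_row F j (map_vec cnj b))"
  proof (rule eq_matI)
    fix k l assume "k < dim_row (ctrans (repl_row F j (map_vec cnj b)))"
      "l < dim_col (ctrans (repl_row F j (map_vec cnj b)))"
    hence kl: "k < n" "l < n" using F by (auto simp: repl_row_def)
    show "repl_col F j b $$ (k, l) = ctrans (repl_row F j (map_vec cnj b)) $$ (k, l)"
      using kl F b h[OF kl] by (simp add: repl_col_def repl_row_def)
  qed (use F in \<open>auto simp: repl_col_def repl_row_def\<close>)
  thus ?thesis using cdet_sub_ctrans[OF _ A j, of "repl_row F j (map_vec cnj b)"] F
    by (simp add: repl_row_def)
qed

section \<open>The adjugate coefficients of a Hermitian matrix\<close>

text \<open>Real scalars are central among the quaternions and can therefore be pulled out of either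
  factor.\<close>

lemma quat_of_real_smult_mult:
  fixes A B :: "quat mat"
  assumes "dim_col A = dim_row B"
  shows "A * (of_real a \<cdot>\<^sub>m B) = of_real a \<cdot>\<^sub>m (A * B)"
    and "(of_real a \<cdot>\<^sub>m A) * B = of_real a \<cdot>\<^sub>m (A * B)"
proof -
  have c: "x * (of_real a * y) = of_real a * (x * y)" for x y :: quat
    by (simp add: quat_eq_iff algebra_simps)
  show "A * (of_real a \<cdot>\<^sub>m B) = of_real a \<cdot>\<^sub>m (A * B)"
    by (rule eq_matI) (use assms c in \<open>auto simp: scalar_prod_def sum_distrib_left intro!: sum.cong\<close>)
  show "(of_real a \<cdot>\<^sub>m A) * B = of_real a \<cdot>\<^sub>m (A * B)"
    by (rule eq_matI) (use assms in \<open>auto simp: scalar_prod_def sum_distrib_left mult.assoc\<close>)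
qed

lemma ctrans_mult:
  assumes "dim_col A = dim_row B"
  shows "ctrans (A * B) = ctrans B * ctrans A"
  by (rule eq_matI) (use assms in \<open>auto simp: scalar_prod_def cnj_sum cnj_mult\<close>)

lemma ctrans_ctrans [simp]: "ctrans (ctrans A) = A"
  by (rule eq_matI) auto

lemma ctrans_one [simp]: "ctrans (1\<^sub>m n) = 1\<^sub>m n"
  by (rule eq_matI) auto

lemma ctrans_zero [simp]: "ctrans (0\<^sub>m m n) = 0\<^sub>m n m"
  by (rule eq_matI) auto

lemma ctrans_minus:
  assumes "dim_row A = dim_row B" "dim_col A = dim_col B"
  shows "ctrans (A - B) = ctrans A - ctrans B"
  by (rule eq_matI) (use assms in auto)

lemma ctrans_smult_of_real [simp]: "ctrans (of_real a \<cdot>\<^sub>m A) = of_real a \<cdot>\<^sub>m ctrans A"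
  by (rule eq_matI) (auto simp: quat_eq_iff)

text \<open>The diagonal entries of \<open>ctrans Y * Y\<close> are the squared norms of the columns
  of \<open>Y\<close>.\<close>

lemma ctrans_mult_self_eq_0:
  assumes Y: "Y \<in> carrier_mat m n" and eq: "ctrans Y * Y = 0\<^sub>m n n"
  shows "Y = 0\<^sub>m m n"
proof (rule eq_matI)
  fix i j assume ij: "i < dim_row (0\<^sub>m m n :: quat mat)" "j < dim_col (0\<^sub>m m n :: quat mat)"
  have q: "Re (cnj x * x) = (Re x)\<^sup>2 + (Im1 x)\<^sup>2 + (Im2 x)\<^sup>2 + (Im3 x)\<^sup>2" for x
    by (simp add: power2_eq_square)
  have "(ctrans Y * Y) $$ (j, j) = (\<Sum>k = 0..<m. cnj (Y $$ (k, j)) * Y $$ (k, j))"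
    using Y ij by (auto simp: scalar_prod_def)
  hence "Re (\<Sum>k = 0..<m. cnj (Y $$ (k, j)) * Y $$ (k, j)) = 0"
    using ij by (simp only: eq index_zero_mat) (simp del: times_quat.simps)
  hence "(\<Sum>k = 0..<m. (Re (Y $$ (k, j)))\<^sup>2 + (Im1 (Y $$ (k, j)))\<^sup>2 + (Im2 (Y $$ (k, j)))\<^sup>2 + (Im3 (Y $$ (k, j)))\<^sup>2) = 0"
    unfolding Re_sum q .
  hence "(Re (Y $$ (i, j)))\<^sup>2 + (Im1 (Y $$ (i, j)))\<^sup>2 + (Im2 (Y $$ (i, j)))\<^sup>2 + (Im3 (Y $$ (i, j)))\<^sup>2 = 0"
    using ij by (subst (asm) sum_nonneg_eq_0_iff) auto
  thus "Y $$ (i, j) = 0\<^sub>m m n $$ (i, j)"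
    using ij by (auto simp: quat_eq_iff add_nonneg_eq_0_iff)
qed (use Y in auto)

text \<open>Over the quaternions the trace itself is not invariant under exchanging two factors; its
  real part is.\<close>

definition re_trace :: "quat mat \<Rightarrow> real" where
  "re_trace M = (\<Sum>i<dim_row M. Re (M $$ (i, i)))"

lemma re_trace_mult_commute:
  assumes "A \<in> carrier_mat m n" "B \<in> carrier_mat n m"
  shows "re_trace (A * B) = re_trace (B * A)"
proof -
  have "re_trace (A * B) = (\<Sum>i<m. \<Sum>k = 0..<n. Re (A $$ (i, k) * B $$ (k, i)))"
    using assms unfolding re_trace_def by (intro sum.cong) (auto simp only: scalar_prod_def Re_sum
      index_mult_mat carrier_matD row_def col_def dim_vec index_vec lessThan_iff atLeastLessThan_iff intro!: sum.cong)
  also have "\<dots> = (\<Sum>k = 0..<n. \<Sum>i<m. Re (B $$ (k, i) * A $$ (i, k)))"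
    by (subst sum.swap) (simp only: Re_mult_commute)
  also have "\<dots> = re_trace (B * A)"
    using assms unfolding re_trace_def lessThan_atLeast0
    by (intro sum.cong) (auto simp only: scalar_prod_def Re_sum
      index_mult_mat carrier_matD row_def col_def dim_vec index_vec lessThan_iff atLeastLessThan_iff intro!: sum.cong)
  finally show ?thesis .
qed

text \<open>Extension by zero makes the Hermitian symmetry hold for all pairs of indices, as
  \<open>hermitian_det\<close> demands.\<close>

definition entry :: "quat mat \<Rightarrow> nat \<Rightarrow> nat \<Rightarrow> quat" where
  "entry F x y = (if x < dim_row F \<and> y < dim_col F then F $$ (x, y) else 0)"

section \<open>Index sets of fixed size\<close>

lemma finite_Lkn [simp]: "finite (Lkn k n)"
  by (rule finite_subset[of _ "Pow {0..<n}"]) (auto simp: Lkn_def)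

lemma finite_Ikn [simp]: "finite (Ikn k n j)"
  by (rule finite_subset[of _ "Lkn k n"]) (auto simp: Ikn_def)

lemma Ikn_D: "A \<in> Ikn k n j \<Longrightarrow> A \<subseteq> {0..<n} \<and> j \<in> A \<and> finite A \<and> card A = k"
  by (auto simp: Ikn_def Lkn_def intro: finite_subset)

lemma Lkn_D: "A \<in> Lkn k n \<Longrightarrow> A \<subseteq> {0..<n} \<and> finite A \<and> card A = k"
  by (auto simp: Lkn_def intro: finite_subset)

lemma sum_Ikn_Suc:
  assumes i: "i < n"
  shows "(\<Sum>A\<in>Ikn (Suc k) n i. f (A - {i})) = (\<Sum>B | B \<in> Lkn k n \<and> i \<notin> B. f B)"
  by (rule sum.reindex_bij_witness[where i = "insert i" and j = "\<lambda>A. A - {i}"])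
    (use i in \<open>auto simp: insert_absorb dest!: Ikn_D Lkn_D\<close>,
     use i in \<open>auto simp: Ikn_def Lkn_def card_insert_if finite_subset\<close>)

locale hermitian_mat =
  fixes F :: "quat mat" and n :: nat
  assumes F: "F \<in> carrier_mat n n" and herm_F: "ctrans F = F"
begin

abbreviation "D \<equiv> set_det (entry F)"

lemma entry_eq: "x < n \<Longrightarrow> y < n \<Longrightarrow> entry F x y = F $$ (x, y)"
  using F by (simp add: entry_def)

sublocale hermitian_det "entry F" D
proof
  fix x y
  show "entry F y x = cnj (entry F x y)"
    using ctrans_index[of y F x] F herm_F by (auto simp: entry_def)
  show "D {} = 1" by (rule set_det_empty)
  fix A :: "nat set" assume A: "finite A" "A \<noteq> {}"
  show "D A = path_sum (entry F) D A (Min A) (Min A)"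
    using row_det_Min[OF A, of "entry F"] row_det_eq_path_sum[OF A(1), of "Min A" "entry F" "Min A"] A by simp
qed

lemma rdet_sub_repl_row_entry:
  assumes A: "A \<subseteq> {0..<n}" and j: "j \<in> A"
  shows "rdet_sub j (repl_row F j b) A = row_det (entry F) A j (\<lambda>y. b $ y)"
proof -
  have fin: "finite A" using A finite_subset by blast
  show ?thesis unfolding rdet_sub_repl_row[OF F A j]
    by (rule row_det_cong[OF fin j]) (use A entry_eq in \<open>auto simp: subset_iff\<close>)
qed

lemma hdet_princ_entry:
  assumes A: "A \<subseteq> {0..<n}"
  shows "hdet (princ F A) = D A"
proof (cases "A = {}")
  case True thus ?thesis by (simp add: hdet_princ[OF F] set_det_empty)
next
  case False
  have fin: "finite A" using A finite_subset by blast
  have M: "Min A \<in> A" using fin False by simp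
  show ?thesis unfolding hdet_princ[OF F A] row_det_Min[OF fin False, symmetric]
    by (rule row_det_cong[OF fin M]) (use A M entry_eq in \<open>auto simp: subset_iff\<close>)
qed

text \<open>The sum of the principal minors of order \<open>k\<close>, stored as a real number;
  \<open>sum_D\<close> shows that taking the real part loses nothing.\<close>

definition coeff :: "nat \<Rightarrow> real" where
  "coeff k = Re (\<Sum>A\<in>Lkn k n. D A)"

lemma sum_D: "(\<Sum>A\<in>Lkn k n. D A) = of_real (coeff k)"
proof -
  have "cnj (\<Sum>A\<in>Lkn k n. D A) = (\<Sum>A\<in>Lkn k n. D A)"
    unfolding cnj_sum by (intro sum.cong refl cnj_D) (auto dest: Lkn_D)
  thus ?thesis unfolding coeff_def by (simp only: self_cnj_iff)
qed

lemma pminors_eq: "pminors k F = of_real (coeff k)"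
  unfolding pminors_def sum_D[symmetric] using F
  by (intro sum.cong) (auto intro!: hdet_princ_entry dest: Lkn_D)

text \<open>Coefficient of \<open>t ^ (n - k)\<close> in the adjugate of \<open>t I + F\<close>.\<close>

definition adj_entry :: "nat set \<Rightarrow> nat \<Rightarrow> nat \<Rightarrow> quat" where
  "adj_entry A x j = (if x = j then D (A - {j}) else if x \<in> A then - P (A - {x}) x j else 0)"

definition adj_coeff :: "nat \<Rightarrow> quat mat" where
  "adj_coeff k = mat n n (\<lambda>(x, j). \<Sum>A\<in>Ikn k n j. adj_entry A x j)"

lemma adj_coeff_carrier [simp]: "adj_coeff k \<in> carrier_mat n n"
  by (simp add: adj_coeff_def)

lemma adj_coeff_dim [simp]: "dim_row (adj_coeff k) = n" "dim_col (adj_coeff k) = n"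
  by (simp_all add: adj_coeff_def)

text \<open>The row determinant is left linear in the replaced row, and \<open>row_det_rec\<close>
  displays its coefficients.\<close>

lemma row_det_adj_entry:
  assumes A: "A \<subseteq> {0..<n}" and j: "j \<in> A"
  shows "row_det (entry F) A j b = (\<Sum>x = 0..<n. b x * adj_entry A x j)"
proof -
  have fin: "finite A" using A finite_subset by blast
  have "row_det (entry F) A j b = b j * D (A - {j}) - (\<Sum>x\<in>A - {j}. b x * P (A - {x}) x j)"
    unfolding row_det_rec[OF fin j] using fin j
    by (intro arg_cong2[where f = "(-)"] sum.cong refl) (simp add: row_det_eq_path_sum)
  also have "\<dots> = b j * adj_entry A j j + (\<Sum>x\<in>A - {j}. b x * adj_entry A x j)"
    unfolding diff_conv_add_uminus sum_negf[symmetric]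
    by (intro arg_cong2[where f = "(+)"] sum.cong) (auto simp: adj_entry_def)
  also have "\<dots> = (\<Sum>x\<in>A. b x * adj_entry A x j)"
    using sum.remove[OF fin j, of "\<lambda>x. b x * adj_entry A x j"] by simp
  also have "\<dots> = (\<Sum>x = 0..<n. b x * adj_entry A x j)"
    by (rule sum.mono_neutral_left) (use A j in \<open>auto simp: adj_entry_def\<close>)
  finally show ?thesis .
qed

text \<open>Multiplying a row by \<open>adj_coeff k\<close> from the right thus produces the sums of
  row determinants that occur as numerators in the theorem.\<close>

lemma sum_row_det:
  assumes j: "j < n"
  shows "(\<Sum>A\<in>Ikn k n j. row_det (entry F) A j b) = (\<Sum>x = 0..<n. b x * adj_coeff k $$ (x, j))"
proof -
  have "(\<Sum>A\<in>Ikn k n j. row_det (entry F) A j b) = (\<Sum>A\<in>Ikn k n j. \<Sum>x = 0..<n. b x * adj_entry A x j)"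
    by (intro sum.cong refl row_det_adj_entry) (auto dest: Ikn_D)
  also have "\<dots> = (\<Sum>x = 0..<n. b x * adj_coeff k $$ (x, j))"
    by (subst sum.swap) (use j in \<open>simp add: adj_coeff_def sum_distrib_left\<close>)
  finally show ?thesis .
qed

lemma mult_adj_coeff_index:
  assumes i: "i < n" and j: "j < n"
  shows "(F * adj_coeff k) $$ (i, j) = (\<Sum>A\<in>Ikn k n j. P A i j)"
proof -
  have "(F * adj_coeff k) $$ (i, j) = (\<Sum>x = 0..<n. entry F i x * adj_coeff k $$ (x, j))"
    using F i j carrier_matD[OF adj_coeff_carrier[of k]] by (auto simp: scalar_prod_def entry_eq intro!: sum.cong)
  also have "\<dots> = (\<Sum>A\<in>Ikn k n j. row_det (entry F) A j (entry F i))" by (rule sum_row_det[OF j, symmetric])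
  also have "\<dots> = (\<Sum>A\<in>Ikn k n j. P A i j)"
    by (intro sum.cong refl row_det_eq_path_sum) (auto dest: Ikn_D)
  finally show ?thesis .
qed

lemma adj_coeff_diag:
  assumes j: "j < n"
  shows "adj_coeff (Suc k) $$ (j, j) = (\<Sum>B | B \<in> Lkn k n \<and> j \<notin> B. D B)"
  using j by (simp add: adj_coeff_def adj_entry_def sum_Ikn_Suc)

text \<open>On the diagonal, the sets of size \<open>k\<close> are split by membership of
  \<open>j\<close>: those without \<open>j\<close> give \<open>adj_coeff (Suc k)\<close>, those with
  \<open>j\<close> give the diagonal path sums. Off the diagonal, removing \<open>i\<close> from a
  set of size \<open>k + 1\<close> leaves a set of size \<open>k\<close> that contains
  \<open>j\<close> but not \<open>i\<close>; the sets containing both can be added freely by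
  \<open>path_sum_offdiag\<close>.\<close>

lemma adj_coeff_Suc: "adj_coeff (Suc k) = of_real (coeff k) \<cdot>\<^sub>m 1\<^sub>m n - F * adj_coeff k"
proof (rule eq_matI)
  fix i j assume "i < dim_row (of_real (coeff k) \<cdot>\<^sub>m 1\<^sub>m n - F * adj_coeff k)"
    "j < dim_col (of_real (coeff k) \<cdot>\<^sub>m 1\<^sub>m n - F * adj_coeff k)"
  hence i: "i < n" and j: "j < n" using F carrier_matD[OF adj_coeff_carrier[of k]] by auto
  have "adj_coeff (Suc k) $$ (i, j) = (if i = j then of_real (coeff k) else 0) - (\<Sum>A\<in>Ikn k n j. P A i j)"
  proof (cases "i = j")
    case True
    have "(\<Sum>A\<in>Ikn k n j. P A j j) = (\<Sum>A\<in>Ikn k n j. D A)"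
      by (intro sum.cong refl path_sum_diag) (auto dest: Ikn_D)
    moreover have "Lkn k n = {B. B \<in> Lkn k n \<and> j \<notin> B} \<union> Ikn k n j" by (auto simp: Ikn_def)
    hence "(\<Sum>B\<in>Lkn k n. D B) = (\<Sum>B | B \<in> Lkn k n \<and> j \<notin> B. D B) + (\<Sum>A\<in>Ikn k n j. D A)"
      by (metis (no_types, lifting) sum.union_disjoint finite_Ikn finite_Lkn finite_Un disjoint_iff Ikn_D mem_Collect_eq)
    ultimately show ?thesis using True adj_coeff_diag[OF j] by (simp add: sum_D)
  next
    case False
    have "adj_coeff (Suc k) $$ (i, j) = (\<Sum>A\<in>Ikn (Suc k) n j. if i \<in> A then - P (A - {i}) i j else 0)"
      using i j False by (simp add: adj_coeff_def adj_entry_def)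
    also have "\<dots> = (\<Sum>A\<in>Ikn (Suc k) n i. if j \<in> A - {i} then - P (A - {i}) i j else 0)"
      by (simp only: sum.If_cases[OF finite_Ikn] sum.neutral_const add_0_right)
        (rule sum.cong, use False in \<open>auto simp: Ikn_def\<close>)
    also have "\<dots> = (\<Sum>B | B \<in> Lkn k n \<and> i \<notin> B. if j \<in> B then - P B i j else 0)"
      by (rule sum_Ikn_Suc[OF i])
    also have "\<dots> = (\<Sum>A\<in>Ikn k n j. if i \<notin> A then - P A i j else 0)"
      by (subst (1 2) sum.inter_filter[symmetric]) (auto simp: Ikn_def intro!: sum.cong)
    also have "\<dots> = (\<Sum>A\<in>Ikn k n j. - P A i j)"
      using path_sum_offdiag False by (intro sum.cong refl) (auto dest!: Ikn_D)
    finally show ?thesis using False by (simp add: sum_negf)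
  qed
  thus "adj_coeff (Suc k) $$ (i, j) = (of_real (coeff k) \<cdot>\<^sub>m 1\<^sub>m n - F * adj_coeff k) $$ (i, j)"
    using i j F mult_adj_coeff_index[OF i j, of k] carrier_matD[OF adj_coeff_carrier[of k]] by auto
qed (use F carrier_matD[OF adj_coeff_carrier] in auto)

lemma coeff_0: "coeff 0 = 1"
proof -
  have "Lkn 0 n = {{}}" by (auto simp: Lkn_def dest: finite_subset)
  thus ?thesis by (simp add: coeff_def set_det_empty)
qed

lemma adj_coeff_0: "adj_coeff 0 = 0\<^sub>m n n"
proof -
  have "Ikn 0 n j = {}" for j using Ikn_D[of _ 0 n j] by fastforce
  thus ?thesis by (intro eq_matI) (auto simp: adj_coeff_def)
qed

lemma adj_coeff_Suc_n: "adj_coeff (Suc n) = 0\<^sub>m n n"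
proof -
  have "A \<notin> Ikn (Suc n) n j" for A j
  proof
    assume "A \<in> Ikn (Suc n) n j"
    hence "A \<subseteq> {0..<n}" "card A = Suc n" by (auto dest: Ikn_D)
    thus False using card_mono[of "{0..<n}" A] by simp
  qed
  hence "Ikn (Suc n) n j = {}" for j by blast
  thus ?thesis by (intro eq_matI) (auto simp: adj_coeff_def)
qed

text \<open>A set of size \<open>k\<close> is counted once for each of the \<open>n - k\<close>
  indices that it misses.\<close>

lemma re_trace_adj_coeff: "re_trace (adj_coeff (Suc k)) = (real n - real k) * coeff k"
proof -
  have "re_trace (adj_coeff (Suc k)) = (\<Sum>j = 0..<n. \<Sum>B | B \<in> Lkn k n \<and> j \<notin> B. Re (D B))"
    unfolding re_trace_def lessThan_atLeast0
    by (intro sum.cong) (auto simp: adj_coeff_diag Re_sum simp: carrier_matD[OF adj_coeff_carrier])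
  also have "\<dots> = (\<Sum>B\<in>Lkn k n. \<Sum>j | j \<in> {0..<n} \<and> j \<notin> B. Re (D B))"
    by (rule sum.swap_restrict) auto
  also have "\<dots> = (\<Sum>B\<in>Lkn k n. (real n - real k) * Re (D B))"
  proof (rule sum.cong[OF refl])
    fix B assume "B \<in> Lkn k n"
    hence B: "B \<subseteq> {0..<n}" "finite B" "card B = k" by (auto dest: Lkn_D)
    have "{j. j \<in> {0..<n} \<and> j \<notin> B} = {0..<n} - B" by auto
    moreover have "card B \<le> n" using card_mono[OF _ B(1)] by simp
    ultimately show "(\<Sum>j | j \<in> {0..<n} \<and> j \<notin> B. Re (D B)) = (real n - real k) * Re (D B)"
      using B by (simp add: card_Diff_subset of_nat_diff)
  qed
  finally show ?thesis by (simp add: coeff_def Re_sum sum_distrib_left)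
qed

text \<open>By \<open>adj_coeff_Suc\<close>, each \<open>adj_coeff k\<close> is a polynomial in
  \<open>F\<close> with real coefficients.\<close>

lemma adj_coeff_commute_herm:
  "F * adj_coeff k = adj_coeff k * F \<and> ctrans (adj_coeff k) = adj_coeff k"
proof (induction k)
  case 0 thus ?case using F by (simp add: adj_coeff_0)
next
  case (Suc k)
  let ?M = "adj_coeff k"
  have c: "?M \<in> carrier_mat n n" by simp
  have I: "1\<^sub>m n \<in> carrier_mat n n" by simp
  have FM: "F * ?M \<in> carrier_mat n n" using F by simp
  have "F * adj_coeff (Suc k) = of_real (coeff k) \<cdot>\<^sub>m F - F * (F * ?M)"
    unfolding adj_coeff_Suc using F FM
    by (subst mult_minus_distrib_mat[OF F]) (auto simp: quat_of_real_smult_mult)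
  moreover have "adj_coeff (Suc k) * F = of_real (coeff k) \<cdot>\<^sub>m F - F * ?M * F"
    unfolding adj_coeff_Suc using F FM
    by (subst minus_mult_distrib_mat[OF _ FM F]) (auto simp: quat_of_real_smult_mult)
  moreover have "F * ?M * F = F * (F * ?M)"
    by (subst assoc_mult_mat[OF F c F]) (simp only: conjunct1[OF Suc])
  moreover have "ctrans (adj_coeff (Suc k)) = adj_coeff (Suc k)"
    unfolding adj_coeff_Suc using F c Suc herm_F
    by (subst ctrans_minus) (auto simp: ctrans_mult)
  ultimately show ?case by simp
qed

lemmas adj_coeff_commute = adj_coeff_commute_herm[THEN conjunct1]
lemmas ctrans_adj_coeff = adj_coeff_commute_herm[THEN conjunct2]

text \<open>Downward induction from \<open>k = n + 1\<close>. When \<open>coeff k\<close> vanishes,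
  the recursion turns \<open>F * adj_coeff (Suc k) = 0\<close> into
  \<open>F * (F * adj_coeff k) = 0\<close>, and one factor \<open>F\<close> can be cancelled because
  \<open>F\<close> is Hermitian.\<close>

lemma mult_adj_coeff_eq_0:
  assumes v: "\<And>k. r < k \<Longrightarrow> k \<le> n \<Longrightarrow> coeff k = 0" and k: "k \<le> Suc n" "r < k"
  shows "F * adj_coeff k = 0\<^sub>m n n"
  using k
proof (induction k rule: inc_induct)
  case base thus ?case using F by (simp add: adj_coeff_Suc_n)
next
  case (step k)
  let ?M = "adj_coeff k"
  have c: "?M \<in> carrier_mat n n" by simp
  have FM: "F * ?M \<in> carrier_mat n n" using F by simp
  have "F * adj_coeff (Suc k) = of_real (coeff k) \<cdot>\<^sub>m F - F * (F * ?M)"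
    unfolding adj_coeff_Suc using F FM
    by (subst mult_minus_distrib_mat[OF F]) (auto simp: quat_of_real_smult_mult)
  hence "of_real 0 \<cdot>\<^sub>m F - F * (F * ?M) = 0\<^sub>m n n" using step v[of k] by simp
  hence z: "F * (F * ?M) = 0\<^sub>m n n"
    using F FM by (auto simp: mat_eq_iff)
  \<comment> \<open>The cancellation: \<open>F * ?M\<close> is annihilated by its own adjoint, hence
    zero.\<close>
  have "ctrans (F * ?M) * (F * ?M) = ?M * F * (F * ?M)"
    using F by (subst ctrans_mult) (simp_all add: herm_F ctrans_adj_coeff)
  also have "\<dots> = ?M * (F * (F * ?M))" by (rule assoc_mult_mat[OF c F FM])
  also have "\<dots> = 0\<^sub>m n n" using c by (simp add: z)
  finally show ?case by (rule ctrans_mult_self_eq_0[OF FM])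
qed

text \<open>Take the largest \<open>r\<close> with \<open>coeff r\<close> nonzero, which exists
  since \<open>coeff 0 = 1\<close>. Then \<open>F * adj_coeff (Suc r) = 0\<close>, which is the
  second claim when expanded.\<close>

lemma ex_projection_coeff:
  obtains r where "coeff r \<noteq> 0" "F * (F * adj_coeff r) = of_real (coeff r) \<cdot>\<^sub>m F"
    "re_trace (F * adj_coeff r) = real r * coeff r"
proof -
  define r where "r = Max {k \<in> {0..n}. coeff k \<noteq> 0}"
  have "r \<in> {k \<in> {0..n}. coeff k \<noteq> 0}" unfolding r_def
    by (rule Max_in) (use coeff_0 in \<open>auto intro!: exI[of _ 0]\<close>)
  hence r: "r \<le> n" "coeff r \<noteq> 0" by auto
  have v: "coeff k = 0" if "r < k" "k \<le> n" for k
  proof (rule ccontr)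
    assume "coeff k \<noteq> 0"
    hence "k \<le> r" unfolding r_def using that by (intro Max_ge) auto
    thus False using that by simp
  qed
  let ?M = "adj_coeff r"
  have c: "?M \<in> carrier_mat n n" by simp
  have FM: "F * ?M \<in> carrier_mat n n" using F by simp
  have "F * adj_coeff (Suc r) = of_real (coeff r) \<cdot>\<^sub>m F - F * (F * ?M)"
    unfolding adj_coeff_Suc using F FM
    by (subst mult_minus_distrib_mat[OF F]) (auto simp: quat_of_real_smult_mult)
  moreover have "F * adj_coeff (Suc r) = 0\<^sub>m n n"
    by (rule mult_adj_coeff_eq_0[of r]) (use r v in auto)
  ultimately have "F * (F * ?M) = of_real (coeff r) \<cdot>\<^sub>m F"
    using F FM by (auto simp: mat_eq_iff)
  moreover have "re_trace (F * ?M) = real r * coeff r"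
  proof -
    \<comment> \<open>Comparison with \<open>re_trace_adj_coeff\<close> gives
      \<open>(n - r) * coeff r = n * coeff r - re_trace (F * ?M)\<close>.\<close>
    have "re_trace (adj_coeff (Suc r)) = real n * coeff r - re_trace (F * ?M)"
      unfolding adj_coeff_Suc re_trace_def using F FM
      by (simp add: sum_subtractf del: index_mult_mat(1))
    thus ?thesis unfolding re_trace_adj_coeff by (simp add: algebra_simps)
  qed
  ultimately show ?thesis using r(2) that by blast
qed

end

section \<open>The Moore-Penrose inverse\<close>

definition penrose :: "quat mat \<Rightarrow> quat mat \<Rightarrow> bool" where
  "penrose A X \<longleftrightarrow> X \<in> carrier_mat (dim_col A) (dim_row A) \<and>
      A * X * A = A \<and> X * A * X = X \<and> ctrans (A * X) = A * X \<and> ctrans (X * A) = X * A"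

lemma penrose_ctrans:
  assumes "penrose A X"
  shows "penrose (ctrans A) (ctrans X)"
proof -
  have X: "X \<in> carrier_mat (dim_col A) (dim_row A)"
    and e: "A * X * A = A" "X * A * X = X" "ctrans (A * X) = A * X" "ctrans (X * A) = X * A"
    using assms by (auto simp: penrose_def)
  have A: "A \<in> carrier_mat (dim_row A) (dim_col A)" by simp
  have AX: "ctrans A * ctrans X = X * A" using X e(4) by (simp add: ctrans_mult)
  have XA: "ctrans X * ctrans A = A * X" using X e(3) by (simp add: ctrans_mult)
  have dX: "dim_row X = dim_col A" "dim_col X = dim_row A" using X by auto
  have c: "ctrans A \<in> carrier_mat (dim_col A) (dim_row A)" "ctrans X \<in> carrier_mat (dim_row A) (dim_col A)"
    using X by auto
  have "ctrans (A * X * A) = ctrans A * (A * X)"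
    by (subst ctrans_mult) (simp_all add: e(3) dX)
  hence "ctrans A * ctrans X * ctrans A = ctrans A"
    using e(1) by (simp only: assoc_mult_mat[OF c(1,2,1)] XA)
  moreover have "ctrans (X * A * X) = ctrans X * (X * A)"
    by (subst ctrans_mult) (simp_all add: e(4) dX)
  hence "ctrans X * ctrans A * ctrans X = ctrans X"
    using e(2) by (simp only: assoc_mult_mat[OF c(2,1,2)] AX)
  ultimately show ?thesis unfolding penrose_def using X e by (simp add: AX XA)
qed

text \<open>\<open>A * X\<close> and \<open>A * Y\<close> are Hermitian and absorb each other, so
  taking adjoints shows that they are equal; likewise \<open>X * A\<close> and \<open>Y * A\<close>.
  Then \<open>X = X * A * X = X * A * Y = Y * A * Y = Y\<close>.\<close>

lemma penrose_unique:
  assumes "penrose A X" "penrose A Y"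
  shows "X = Y"
proof -
  define n s where "n = dim_row A" and "s = dim_col A"
  have A: "A \<in> carrier_mat n s" by (auto simp: n_def s_def)
  have *: "X \<in> carrier_mat s n \<and> A * (X * A) = A \<and> X * (A * X) = X \<and> ctrans (A * X) = A * X \<and> ctrans (X * A) = X * A"
    if "penrose A X" for X
  proof -
    have X: "X \<in> carrier_mat s n" using that by (auto simp: penrose_def n_def s_def)
    show ?thesis using that X unfolding penrose_def
      using assoc_mult_mat[OF A X A] assoc_mult_mat[OF X A X] by simp
  qed
  note X = *[OF assms(1)] and Y = *[OF assms(2)]
  have Xc: "X \<in> carrier_mat s n" and Yc: "Y \<in> carrier_mat s n" using X Y by auto
  have AX: "A * X \<in> carrier_mat n n" and AY: "A * Y \<in> carrier_mat n n"
    and XA: "X * A \<in> carrier_mat s s" and YA: "Y * A \<in> carrier_mat s s" using A Xc Yc by auto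
  have a: "(A * Y) * (A * X) = A * X"
    using assoc_mult_mat[OF AY A Xc] assoc_mult_mat[OF A Yc A] Y by simp
  have b: "(A * X) * (A * Y) = A * Y"
    using assoc_mult_mat[OF AX A Yc] assoc_mult_mat[OF A Xc A] X by simp
  have "A * X = ctrans ((A * Y) * (A * X))" using X a by simp
  also have "\<dots> = ctrans (A * X) * ctrans (A * Y)" using carrier_matD[OF AX] carrier_matD[OF AY] by (intro ctrans_mult) simp
  also have "\<dots> = (A * X) * (A * Y)" using X Y by (simp only:)
  finally have e1: "A * X = A * Y" using b by simp
  have c: "(X * A) * (Y * A) = X * A"
    using assoc_mult_mat[OF Xc A YA] Y by simp
  have d: "(Y * A) * (X * A) = Y * A"
    using assoc_mult_mat[OF Yc A XA] X by simp
  have "X * A = ctrans ((X * A) * (Y * A))" using X c by simp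
  also have "\<dots> = ctrans (Y * A) * ctrans (X * A)" using carrier_matD[OF XA] carrier_matD[OF YA] by (intro ctrans_mult) simp
  also have "\<dots> = (Y * A) * (X * A)" using X Y by (simp only:)
  finally have e2: "X * A = Y * A" using d by simp
  have "X = X * (A * Y)" using X e1 by simp
  also have "\<dots> = (Y * A) * Y" using assoc_mult_mat[OF Xc A Yc] e2 by simp
  also have "\<dots> = Y" using assoc_mult_mat[OF Yc A Yc] Y by simp
  finally show ?thesis .
qed

lemma minus_mat_eq_0D:
  assumes "A \<in> carrier_mat m n" "B \<in> carrier_mat m n" "A - B = (0\<^sub>m m n :: quat mat)"
  shows "A = B"
proof (rule eq_matI)
  fix i j assume ij: "i < dim_row B" "j < dim_col B"
  have "(A - B) $$ (i, j) = 0" using assms(1,2) ij by (simp only: assms(3)) simp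
  thus "A $$ (i, j) = B $$ (i, j)" using ij by simp
qed (use assms in auto)

lemma re_trace_smult:
  assumes "A \<in> carrier_mat n n"
  shows "re_trace (of_real a \<cdot>\<^sub>m A) = a * re_trace A"
  using assms by (simp add: re_trace_def sum_distrib_left)

lemma hermitian_mat_gram:
  assumes "B \<in> carrier_mat n s"
  shows "hermitian_mat (B * ctrans B) n"
  by unfold_locales (use assms in \<open>auto simp: ctrans_mult\<close>)

text \<open>The candidate is \<open>ctrans B * adj_coeff r\<close>, divided by
  \<open>coeff r\<close>. Multiplying it by \<open>B\<close> from the left gives a Hermitian
  \<open>E\<close> with \<open>E * F = F\<close>, and the Penrose equations reduce to
  \<open>E * B = B\<close> and \<open>X * E = X\<close>.\<close>

lemma ex_penrose:
  assumes B: "B \<in> carrier_mat n s"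
  defines "F \<equiv> B * ctrans B"
  obtains r where "hermitian_mat.coeff F n r \<noteq> 0"
    "penrose B (of_real (1 / hermitian_mat.coeff F n r) \<cdot>\<^sub>m (ctrans B * hermitian_mat.adj_coeff F n r))"
    "re_trace (B * (of_real (1 / hermitian_mat.coeff F n r) \<cdot>\<^sub>m (ctrans B * hermitian_mat.adj_coeff F n r))) = real r"
proof -
  interpret hermitian_mat F n unfolding F_def by (rule hermitian_mat_gram[OF B])
  obtain r where r: "coeff r \<noteq> 0" "F * (F * adj_coeff r) = of_real (coeff r) \<cdot>\<^sub>m F"
    "re_trace (F * adj_coeff r) = real r * coeff r"
    using ex_projection_coeff by metis
  define M a where "M = adj_coeff r" and "a = 1 / coeff r"
  define E where "E = of_real a \<cdot>\<^sub>m (F * M)"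
  define X where "X = of_real a \<cdot>\<^sub>m (ctrans B * M)"
  have a: "of_real a * of_real (coeff r) = (1 :: quat)"
    using r(1) unfolding a_def of_real_mult[symmetric] by simp
  have Bs: "ctrans B \<in> carrier_mat s n" using B by simp
  have M: "M \<in> carrier_mat n n" "ctrans M = M" "F * M = M * F"
    by (simp_all add: M_def ctrans_adj_coeff adj_coeff_commute)
  have FM: "F * M \<in> carrier_mat n n" using F M by simp
  have E: "E \<in> carrier_mat n n" using FM by (simp add: E_def)
  have X: "X \<in> carrier_mat s n" using B M by (simp add: X_def)
  have BX: "B * X = E"
    unfolding X_def E_def F_def using B M(1)
    by (simp add: quat_of_real_smult_mult assoc_mult_mat[OF B Bs M(1)])
  have EF: "E * F = F"
  proof -
    have "E * F = of_real a \<cdot>\<^sub>m (F * M * F)" unfolding E_def using F M(1) by (simp add: quat_of_real_smult_mult)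
    also have "F * M * F = F * (F * M)" using assoc_mult_mat[OF F M(1) F] M(3) by simp
    also have "of_real a \<cdot>\<^sub>m (F * (F * M)) = F"
      unfolding M_def r(2) using F a by (intro eq_matI) (simp_all add: mult.assoc[symmetric])
    finally show ?thesis .
  qed
  have cE: "ctrans E = E"
    unfolding E_def using F M herm_F by (simp add: ctrans_mult)
  have EB: "E * B = B"
  proof -
    \<comment> \<open>The defect \<open>Z\<close> satisfies \<open>Z * ctrans B = 0\<close>, because
      \<open>E * F = F\<close>. Since \<open>ctrans Z = ctrans B * E - ctrans B\<close>, also
      \<open>Z * ctrans Z = 0\<close>, which forces \<open>Z = 0\<close>.\<close>
    define Z where "Z = E * B - B"
    have EBc: "E * B \<in> carrier_mat n s" using E B by simp
    have Z: "Z \<in> carrier_mat n s" unfolding Z_def using B by (rule minus_carrier_mat)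
    have "Z * ctrans B = E * B * ctrans B - F"
      unfolding Z_def F_def by (rule minus_mult_distrib_mat[OF EBc B Bs])
    also have "\<dots> = 0\<^sub>m n n" using assoc_mult_mat[OF E B Bs] EF F by (simp flip: F_def)
    finally have 1: "Z * ctrans B = 0\<^sub>m n n" .
    have "ctrans Z = ctrans B * E - ctrans B"
      unfolding Z_def using E B by (simp add: ctrans_minus ctrans_mult cE)
    hence "Z * ctrans Z = Z * (ctrans B * E) - Z * ctrans B"
      using mult_minus_distrib_mat[OF Z _ Bs, of "ctrans B * E"] Bs E by simp
    also have "Z * (ctrans B * E) = Z * ctrans B * E" using assoc_mult_mat[OF Z Bs E] by simp
    finally have "Z * ctrans Z = 0\<^sub>m n n" unfolding 1 using E by simp
    hence "ctrans Z = 0\<^sub>m s n" using ctrans_mult_self_eq_0[of "ctrans Z" s n] Z by simp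
    from arg_cong[OF this, of ctrans] have "Z = 0\<^sub>m n s" by simp
    thus ?thesis unfolding Z_def by (rule minus_mat_eq_0D[OF EBc B])
  qed
  have BE: "ctrans B * E = ctrans B"
    using arg_cong[OF EB, of ctrans] E B by (simp add: ctrans_mult cE)
  have XB: "ctrans (X * B) = X * B"
  proof -
    have "X * B = of_real a \<cdot>\<^sub>m (ctrans B * M * B)"
      unfolding X_def using B M by (simp add: quat_of_real_smult_mult)
    moreover have "ctrans (ctrans B * M * B) = ctrans B * M * B"
      using B M assoc_mult_mat[OF Bs M(1) B] by (simp add: ctrans_mult)
    ultimately show ?thesis by simp
  qed
  have XE: "X * E = X"
  proof -
    have "M * E = E * M"
      unfolding E_def using M F assoc_mult_mat[OF M(1) F M(1)] by (simp add: quat_of_real_smult_mult)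
    have "X * E = of_real a \<cdot>\<^sub>m (ctrans B * M * E)"
      unfolding X_def using B M E by (simp add: quat_of_real_smult_mult)
    also have "ctrans B * M * E = ctrans B * (E * M)"
      using assoc_mult_mat[OF Bs M(1) E] \<open>M * E = E * M\<close> by simp
    also have "\<dots> = ctrans B * M" using assoc_mult_mat[OF Bs E M(1)] BE by simp
    finally show ?thesis by (simp add: X_def)
  qed
  have "penrose B X"
    unfolding penrose_def using X B BX EB cE XB XE assoc_mult_mat[OF X B X] by simp
  moreover have "re_trace (B * X) = real r"
    using r(1,3) by (simp only: BX E_def re_trace_smult[OF FM]) (simp add: a_def M_def)
  ultimately show ?thesis using that r(1) unfolding X_def a_def M_def by blast
qed

lemma penrose_mpinv: "penrose A (mpinv A)"
proof -
  have "A \<in> carrier_mat (dim_row A) (dim_col A)" by simp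
  then obtain X where "penrose A X" using ex_penrose by metis
  hence "penrose A (THE X. penrose A X)" using penrose_unique by (intro theI[of "penrose A"])
  thus ?thesis unfolding mpinv_def penrose_def .
qed

lemma mpinv_eqI: "penrose A X \<Longrightarrow> mpinv A = X"
  using penrose_unique penrose_mpinv by blast

lemma mpinv_carrier: "A \<in> carrier_mat m n \<Longrightarrow> mpinv A \<in> carrier_mat n m"
  using penrose_mpinv[of A] by (auto simp: penrose_def)

lemma ctrans_mpinv: "ctrans (mpinv A) = mpinv (ctrans A)"
  using mpinv_eqI[OF penrose_ctrans[OF penrose_mpinv]] ..

section \<open>The rank as the trace of a projection\<close>

lemma ex_max_right_indep:
  obtains S where "S \<subseteq> {0..<dim_col A}" "right_indep_cols A S" "card S = qrank A"
    "\<And>T. T \<subseteq> {0..<dim_col A} \<Longrightarrow> right_indep_cols A T \<Longrightarrow> card T \<le> qrank A"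
proof -
  let ?C = "{S. S \<subseteq> {0..<dim_col A} \<and> right_indep_cols A S}"
  have fin: "finite (card ` ?C)" by (rule finite_imageI, rule finite_subset[of _ "Pow {0..<dim_col A}"]) auto
  have "{} \<in> ?C" by (auto simp: right_indep_cols_def)
  hence "Max (card ` ?C) \<in> card ` ?C" using fin by (intro Max_in) auto
  then obtain S where "S \<in> ?C" "card S = qrank A" unfolding qrank_def by auto
  moreover have "card T \<le> qrank A" if "T \<in> ?C" for T
    unfolding qrank_def using fin that by (intro Max_ge) auto
  ultimately show ?thesis using that by blast
qed

text \<open>By maximality, adjoining a further column creates a linear relation, which must involve
  the new column with a nonzero coefficient.\<close>

lemma column_in_span:
  assumes S: "S \<subseteq> {0..<dim_col A}" "right_indep_cols A S"
    and max: "\<And>T. T \<subseteq> {0..<dim_col A} \<Longrightarrow> right_indep_cols A T \<Longrightarrow> card T \<le> card S"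
    and j: "j < dim_col A"
  shows "\<exists>c. \<forall>i<dim_row A. A $$ (i, j) = (\<Sum>k\<in>S. A $$ (i, k) * c k)"
proof (cases "j \<in> S")
  have fin: "finite S" using S(1) finite_subset by blast
  {
    case True
    have "(\<Sum>k\<in>S. A $$ (i, k) * (if k = j then 1 else 0)) = A $$ (i, j)" for i
      using fin True by (simp add: if_distrib sum.delta cong: if_cong)
    thus ?thesis by (intro exI[of _ "\<lambda>k. if k = j then 1 else 0"]) simp
  next
    case False
    have "\<not> right_indep_cols A (insert j S)"
      using max[of "insert j S"] S(1) j False fin by auto
    then obtain c where c: "\<forall>i<dim_row A. (\<Sum>k\<in>insert j S. A $$ (i, k) * c k) = 0"
      and nz: "\<exists>k\<in>insert j S. c k \<noteq> 0" unfolding right_indep_cols_def by blast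
    have cj: "c j \<noteq> 0"
    proof
      assume "c j = 0"
      hence "\<forall>i<dim_row A. (\<Sum>k\<in>S. A $$ (i, k) * c k) = 0" using c fin False by simp
      thus False using S(2) nz \<open>c j = 0\<close> unfolding right_indep_cols_def by blast
    qed
    \<comment> \<open>Coefficients act on the right of the columns, so the relation is solved by
      multiplying by \<open>inverse (c j)\<close> from the right.\<close>
    have "A $$ (i, j) = (\<Sum>k\<in>S. A $$ (i, k) * (- c k * inverse (c j)))" if "i < dim_row A" for i
    proof -
      have "A $$ (i, j) * c j = - (\<Sum>k\<in>S. A $$ (i, k) * c k)"
        using c that fin False by (simp add: eq_neg_iff_add_eq_0)
      hence "A $$ (i, j) * c j * inverse (c j) = - (\<Sum>k\<in>S. A $$ (i, k) * c k) * inverse (c j)" by simp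
      thus ?thesis using cj by (simp add: mult.assoc sum_distrib_right sum_negf)
    qed
    thus ?thesis by (intro exI[of _ "\<lambda>k. - c k * inverse (c j)"] allI impI)
  }
qed

text \<open>The projection \<open>A A\<^sup>\<dagger>\<close> is also the projection onto the span of a maximal independent set
  of columns, for which the Moore-Penrose inverse is a left inverse; compare traces.\<close>

lemma qrank_eq_re_trace:
  assumes A: "A \<in> carrier_mat n s"
  shows "real (qrank A) = re_trace (A * mpinv A)"
proof -
  obtain S where S: "S \<subseteq> {0..<dim_col A}" "right_indep_cols A S" "card S = qrank A"
    "\<And>T. T \<subseteq> {0..<dim_col A} \<Longrightarrow> right_indep_cols A T \<Longrightarrow> card T \<le> qrank A"
    using ex_max_right_indep by blast
  define r where "r = qrank A"
  have fin: "finite S" using S(1) finite_subset by blast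
  then obtain f where f: "bij_betw f {0..<r} S"
    using ex_bij_betw_nat_finite[of S] S(3) r_def by auto
  have fs: "f k < s" if "k < r" for k using bij_betwE[OF f] S(1) A that by fastforce
  define Bs where "Bs = mat n r (\<lambda>(i, k). A $$ (i, f k))"
  define Z X where "Z = mpinv Bs" and "X = mpinv A"
  have Bs: "Bs \<in> carrier_mat n r" by (simp add: Bs_def)
  have Z: "Z \<in> carrier_mat r n" unfolding Z_def by (rule mpinv_carrier[OF Bs])
  have X: "X \<in> carrier_mat s n" unfolding X_def by (rule mpinv_carrier[OF A])
  have pZ: "Bs * Z * Bs = Bs" "ctrans (Bs * Z) = Bs * Z"
    using penrose_mpinv[of Bs] by (auto simp: penrose_def Z_def)
  have pX: "A * X * A = A" "ctrans (A * X) = A * X"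
    using penrose_mpinv[of A] by (auto simp: penrose_def X_def)
  \<comment> \<open>Right independence of the selected columns is injectivity of \<open>Bs\<close>
    under left multiplication, applied to each column of \<open>Y\<close>.\<close>
  have inj: "Y = 0\<^sub>m r r" if Y: "Y \<in> carrier_mat r r" and z: "Bs * Y = 0\<^sub>m n r" for Y
  proof (rule eq_matI)
    fix k l assume "k < dim_row (0\<^sub>m r r :: quat mat)" "l < dim_col (0\<^sub>m r r :: quat mat)"
    hence kl: "k < r" "l < r" by auto
    let ?g = "inv_into {0..<r} f"
    have g: "?g (f k) = k" if "k < r" for k using f that by (auto simp: bij_betw_def)
    have v: "(\<Sum>j\<in>S. A $$ (i, j) * Y $$ (?g j, l)) = 0" if i: "i < dim_row A" for i
    proof -
      have "(\<Sum>j\<in>S. A $$ (i, j) * Y $$ (?g j, l)) = (\<Sum>k = 0..<r. A $$ (i, f k) * Y $$ (k, l))"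
        by (subst sum.reindex_bij_betw[OF f, symmetric]) (simp add: g)
      also have "\<dots> = (Bs * Y) $$ (i, l)" using Y kl i A by (auto simp: Bs_def scalar_prod_def)
      finally show ?thesis using z kl i A by simp
    qed
    have "\<forall>j\<in>S. Y $$ (?g j, l) = 0"
      by (rule mp[OF spec[OF S(2)[unfolded right_indep_cols_def], of "\<lambda>j. Y $$ (?g j, l)"]])
        (intro allI impI v)
    moreover have "f k \<in> S" using bij_betwE[OF f] kl by auto
    ultimately have "Y $$ (?g (f k), l) = 0" by (rule bspec)
    thus "Y $$ (k, l) = 0\<^sub>m r r $$ (k, l)" using g[OF kl(1)] kl by simp
  qed (use Y in auto)
  \<comment> \<open>The Penrose equation \<open>Bs * Z * Bs = Bs\<close> says that \<open>Bs\<close>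
    annihilates \<open>Z * Bs - 1\<close>.\<close>
  have ZB: "Z * Bs = 1\<^sub>m r"
  proof -
    have ZBc: "Z * Bs \<in> carrier_mat r r" using Z Bs by simp
    have "Bs * (Z * Bs - 1\<^sub>m r) = Bs * (Z * Bs) - Bs * 1\<^sub>m r"
      by (rule mult_minus_distrib_mat[OF Bs ZBc]) simp
    also have "\<dots> = 0\<^sub>m n r" using assoc_mult_mat[OF Bs Z Bs] pZ Bs by simp
    finally have "Z * Bs - 1\<^sub>m r = 0\<^sub>m r r" by (intro inj) (use ZBc in auto)
    thus ?thesis by (rule minus_mat_eq_0D[OF ZBc one_carrier_mat])
  qed
  have "\<forall>j. \<exists>c. j < s \<longrightarrow> (\<forall>i<n. A $$ (i, j) = (\<Sum>k\<in>S. A $$ (i, k) * c k))"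
    using column_in_span[OF S(1,2)] S(3,4) A by auto
  then obtain c where c: "\<And>i j. j < s \<Longrightarrow> i < n \<Longrightarrow> A $$ (i, j) = (\<Sum>k\<in>S. A $$ (i, k) * c j k)" by metis
  \<comment> \<open>Coordinates of all columns of \<open>A\<close> in terms of the selected
    ones.\<close>
  define Dm where "Dm = mat r s (\<lambda>(k, j). c j (f k))"
  have Dm: "Dm \<in> carrier_mat r s" by (simp add: Dm_def)
  have ABD: "A = Bs * Dm"
  proof (rule eq_matI)
    fix i j assume "i < dim_row (Bs * Dm)" "j < dim_col (Bs * Dm)"
    hence ij: "i < n" "j < s" by (auto simp: Bs_def Dm_def)
    have "A $$ (i, j) = (\<Sum>k = 0..<r. A $$ (i, f k) * c j (f k))"
      unfolding c[OF ij(2,1)] by (rule sum.reindex_bij_betw[OF f, symmetric])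
    thus "A $$ (i, j) = (Bs * Dm) $$ (i, j)" using ij by (auto simp: Bs_def Dm_def scalar_prod_def)
  qed (use A Bs Dm in auto)
  \<comment> \<open>Selection matrix: with \<open>A = Bs * Dm\<close> and
    \<open>Bs = A * Sel\<close>, the two column spaces coincide, so the two projections absorb each
    other.\<close>
  define Sel where "Sel = mat s r (\<lambda>(j, k). if j = f k then 1 else 0 :: quat)"
  have Sel: "Sel \<in> carrier_mat s r" by (simp add: Sel_def)
  have BAS: "Bs = A * Sel"
  proof (rule eq_matI)
    fix i k assume "i < dim_row (A * Sel)" "k < dim_col (A * Sel)"
    hence ik: "i < n" "k < r" using A by (auto simp: Sel_def)
    have "(A * Sel) $$ (i, k) = (\<Sum>j = 0..<s. A $$ (i, j) * (if j = f k then 1 else 0))"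
      using ik A by (auto simp: Sel_def scalar_prod_def)
    also have "\<dots> = A $$ (i, f k)" using fs[OF ik(2)]
      by (simp add: if_distrib sum.delta cong: if_cong)
    finally show "Bs $$ (i, k) = (A * Sel) $$ (i, k)" using ik by (simp add: Bs_def)
  qed (use A Bs Sel in auto)
  have BZ: "Bs * Z \<in> carrier_mat n n" and AX: "A * X \<in> carrier_mat n n" and SZ: "Sel * Z \<in> carrier_mat s n"
    and DX: "Dm * X \<in> carrier_mat r n" using Bs Z A X Sel Dm by auto
  have "A * X = Bs * (Dm * X)" using ABD assoc_mult_mat[OF Bs Dm X] by simp
  hence 1: "(Bs * Z) * (A * X) = A * X"
    using assoc_mult_mat[OF BZ Bs DX] pZ by simp
  have "Bs * Z = A * (Sel * Z)" using BAS assoc_mult_mat[OF A Sel Z] by simp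
  hence 2: "(A * X) * (Bs * Z) = Bs * Z"
    using assoc_mult_mat[OF AX A SZ] pX by simp
  have "A * X = ctrans ((Bs * Z) * (A * X))" using pX 1 by simp
  also have "\<dots> = ctrans (A * X) * ctrans (Bs * Z)"
    using carrier_matD[OF BZ] carrier_matD[OF AX] by (intro ctrans_mult) simp
  also have "\<dots> = Bs * Z" using pX pZ 2 by (simp only:)
  finally have "re_trace (A * X) = re_trace (Bs * Z)" by simp
  also have "\<dots> = re_trace (1\<^sub>m r)" using re_trace_mult_commute[OF Bs Z] ZB by simp
  also have "\<dots> = real r" by (simp add: re_trace_def)
  finally show ?thesis by (simp add: X_def r_def)
qed

text \<open>The rank of the adjoint is the trace of the adjoint of \<open>mpinv A * A\<close>, a
  Hermitian matrix with the same real trace as \<open>A * mpinv A\<close>.\<close>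

lemma qrank_ctrans:
  assumes A: "A \<in> carrier_mat m p"
  shows "qrank (ctrans A) = qrank A"
proof -
  have X: "mpinv A \<in> carrier_mat p m" by (rule mpinv_carrier[OF A])
  have "real (qrank (ctrans A)) = re_trace (ctrans A * ctrans (mpinv A))"
    using qrank_eq_re_trace[of "ctrans A" p m] A by (simp add: ctrans_mpinv)
  also have "ctrans A * ctrans (mpinv A) = mpinv A * A"
    using penrose_mpinv[of A] A X by (simp add: penrose_def ctrans_mult[symmetric])
  also have "re_trace (mpinv A * A) = re_trace (A * mpinv A)" by (rule re_trace_mult_commute[OF X A])
  finally show ?thesis using qrank_eq_re_trace[OF A] by simp
qed

text \<open>The index \<open>r\<close> from \<open>ex_penrose\<close> is the real trace of
  \<open>B * mpinv B\<close>, which is the rank.\<close>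

lemma mpinv_eq_adj_coeff:
  assumes B: "B \<in> carrier_mat n s"
  defines "F \<equiv> B * ctrans B"
  shows "hermitian_mat.coeff F n (qrank B) \<noteq> 0"
    and "mpinv B = of_real (1 / hermitian_mat.coeff F n (qrank B)) \<cdot>\<^sub>m (ctrans B * hermitian_mat.adj_coeff F n (qrank B))"
proof -
  obtain r where r: "hermitian_mat.coeff F n r \<noteq> 0"
    "penrose B (of_real (1 / hermitian_mat.coeff F n r) \<cdot>\<^sub>m (ctrans B * hermitian_mat.adj_coeff F n r))"
    "re_trace (B * (of_real (1 / hermitian_mat.coeff F n r) \<cdot>\<^sub>m (ctrans B * hermitian_mat.adj_coeff F n r))) = real r"
    unfolding F_def using ex_penrose[OF B] by blast
  have "real (qrank B) = real r"
    using qrank_eq_re_trace[OF B] r(3) unfolding mpinv_eqI[OF r(2)] by simp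
  thus "hermitian_mat.coeff F n (qrank B) \<noteq> 0"
    "mpinv B = of_real (1 / hermitian_mat.coeff F n (qrank B)) \<cdot>\<^sub>m (ctrans B * hermitian_mat.adj_coeff F n (qrank B))"
    using r(1) mpinv_eqI[OF r(2)] by simp_all
qed

section \<open>Entrywise formulas for products with a Moore-Penrose inverse\<close>

lemma ex_pminors_gram:
  assumes "B \<in> carrier_mat n s"
  obtains d where "d \<noteq> 0" "pminors (qrank B) (B * ctrans B) = of_real d"
  using hermitian_mat.pminors_eq[OF hermitian_mat_gram[OF assms]] mpinv_eq_adj_coeff(1)[OF assms] that
  by blast

text \<open>By \<open>mpinv_eq_adj_coeff\<close>, \<open>Y * mpinv B\<close> is a real multiple of
  \<open>Y * ctrans B * adj_coeff r\<close> with \<open>r\<close> the rank, and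
  \<open>sum_row_det\<close> evaluates its entries. All row determinant formulas of the theorem are
  instances of this one.\<close>

lemma mult_mpinv_index:
  assumes B: "B \<in> carrier_mat n s" and Y: "Y \<in> carrier_mat m s" and i: "i < m" and j: "j < n"
  shows "(Y * mpinv B) $$ (i, j) =
    (\<Sum>\<alpha>\<in>Ikn (qrank B) n j. rdet_sub j (repl_row (B * ctrans B) j (row (Y * ctrans B) i)) \<alpha>)
      / pminors (qrank B) (B * ctrans B)"
proof -
  let ?F = "B * ctrans B" and ?r = "qrank B"
  interpret hermitian_mat ?F n by (rule hermitian_mat_gram[OF B])
  define a where "a = 1 / coeff ?r"
  have X: "mpinv B = of_real a \<cdot>\<^sub>m (ctrans B * adj_coeff ?r)"
    unfolding a_def by (rule mpinv_eq_adj_coeff(2)[OF B])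
  have Bs: "ctrans B \<in> carrier_mat s n" using B by simp
  have YB: "Y * ctrans B \<in> carrier_mat m n" using Y B by simp
  let ?b = "row (Y * ctrans B) i"
  have "Y * mpinv B = of_real a \<cdot>\<^sub>m (Y * ctrans B * adj_coeff ?r)"
    unfolding X using assoc_mult_mat[OF Y Bs adj_coeff_carrier] Y B
    by (simp add: quat_of_real_smult_mult)
  hence "(Y * mpinv B) $$ (i, j) = of_real a * (\<Sum>x = 0..<n. ?b $ x * adj_coeff ?r $$ (x, j))"
    using i j YB by (auto simp: scalar_prod_def)
  also have "(\<Sum>x = 0..<n. ?b $ x * adj_coeff ?r $$ (x, j)) = (\<Sum>\<alpha>\<in>Ikn ?r n j. rdet_sub j (repl_row ?F j ?b) \<alpha>)"
    unfolding sum_row_det[OF j, symmetric]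
    by (intro sum.cong refl rdet_sub_repl_row_entry[symmetric]) (auto dest: Ikn_D)
  also have "of_real a * \<dots> = \<dots> / pminors ?r ?F"

    unfolding pminors_eq divide_quat_def quat_real_commute a_def
    by (simp only: divide_inverse of_real_inverse mult_1_left)
  finally show ?thesis .
qed

text \<open>The adjoint of the row formula for \<open>ctrans Y * mpinv (ctrans A)\<close>:
  conjugation turns row determinants into column determinants and leaves the real denominator
  unchanged.\<close>

lemma mpinv_mult_index:
  assumes A: "A \<in> carrier_mat m p" and Y: "Y \<in> carrier_mat m q" and g: "g < p" and f: "f < q"
  shows "(mpinv A * Y) $$ (g, f) =
    (\<Sum>\<beta>\<in>Ikn (qrank A) p g. cdet_sub g (repl_col (ctrans A * A) g (col (ctrans A * Y) f)) \<beta>)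
      / pminors (qrank A) (ctrans A * A)"
proof -
  let ?F = "ctrans A * A" and ?r = "qrank A"
  have As: "ctrans A \<in> carrier_mat p m" and Ys: "ctrans Y \<in> carrier_mat q m" using A Y by auto
  have X: "mpinv A \<in> carrier_mat p m" by (rule mpinv_carrier[OF A])
  interpret hermitian_mat ?F p using hermitian_mat_gram[OF As] by simp
  obtain d where d: "pminors ?r ?F = of_real d" "d \<noteq> 0"
    using ex_pminors_gram[OF As] qrank_ctrans[OF A] by (metis ctrans_ctrans)
  have "ctrans (mpinv A * Y) = ctrans Y * mpinv (ctrans A)"
    using X Y by (simp add: ctrans_mult ctrans_mpinv)
  hence "(mpinv A * Y) $$ (g, f) = cnj ((ctrans Y * mpinv (ctrans A)) $$ (f, g))"
    using X Y g f ctrans_index[of f "mpinv A * Y" g] by simp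
  also have "\<dots> = cnj ((\<Sum>\<alpha>\<in>Ikn ?r p g. rdet_sub g (repl_row ?F g (row (ctrans Y * A) f)) \<alpha>) / of_real d)"
    using mult_mpinv_index[OF As Ys f g] d(1) by (simp add: qrank_ctrans[OF A])
  also have "\<dots> = (\<Sum>\<alpha>\<in>Ikn ?r p g. cnj (rdet_sub g (repl_row ?F g (row (ctrans Y * A) f)) \<alpha>)) / of_real d"
    by (simp add: divide_quat_def cnj_mult quat_real_commute cnj_sum flip: of_real_inverse)
  also have "row (ctrans Y * A) f = map_vec cnj (col (ctrans A * Y) f)"
    using A Y f by (intro eq_vecI) (auto simp: scalar_prod_def cnj_sum cnj_mult)
  also have "(\<Sum>\<alpha>\<in>Ikn ?r p g. cnj (rdet_sub g (repl_row ?F g (map_vec cnj (col (ctrans A * Y) f))) \<alpha>)) =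
    (\<Sum>\<beta>\<in>Ikn ?r p g. cdet_sub g (repl_col ?F g (col (ctrans A * Y) f)) \<beta>)"
    by (intro sum.cong refl cdet_sub_repl_col[OF F herm_F, symmetric]) (use A in \<open>auto dest: Ikn_D\<close>)
  finally show ?thesis unfolding d(1) .
qed

lemma L_mat_carrier:
  assumes "A \<in> carrier_mat m n"
  shows "L_mat A \<in> carrier_mat n n"
  using assms mpinv_carrier[OF assms] by (simp add: L_mat_def minus_carrier_mat)

section \<open>Determinantal representations\<close>

lemma divide_of_real_quat: "x / of_real a = inverse a *\<^sub>R (x :: quat)"
  by (simp add: divide_inverse scaleR_conv_of_real quat_real_commute flip: of_real_inverse)

lemma cnj_scaleR: "cnj (a *\<^sub>R x) = a *\<^sub>R cnj x"
  by (simp add: quat_eq_iff)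

lemma row_det_scaleR: "row_det G A j (\<lambda>y. a *\<^sub>R b y) = a *\<^sub>R row_det G A j b"
  by (simp add: row_det_def scaleR_sum_right)

text \<open>Serves to move the real denominator of an inner formula out of the replaced row when two
  formulas are nested.\<close>

lemma rdet_sub_repl_row_scaleR:
  assumes F: "F \<in> carrier_mat n n" and A: "A \<subseteq> {0..<n}" and j: "j \<in> A"
    and b: "\<And>y. y < n \<Longrightarrow> b' $ y = a *\<^sub>R b $ y"
  shows "rdet_sub j (repl_row F j b') A = a *\<^sub>R rdet_sub j (repl_row F j b) A"
proof -
  have fin: "finite A" using A finite_subset by blast
  show ?thesis unfolding rdet_sub_repl_row[OF F A j] row_det_scaleR[symmetric]
    by (rule row_det_cong[OF fin j]) (use A b in auto)
qed

lemma cdet_sub_repl_col_scaleR: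
  assumes F: "F \<in> carrier_mat n n" "ctrans F = F" and A: "A \<subseteq> {0..<n}" and j: "j \<in> A"
    and dim: "dim_vec b = n" "dim_vec b' = n"
    and b: "\<And>y. y < n \<Longrightarrow> b' $ y = a *\<^sub>R b $ y"
  shows "cdet_sub j (repl_col F j b') A = a *\<^sub>R cdet_sub j (repl_col F j b) A"
  unfolding cdet_sub_repl_col[OF F A j dim(1)] cdet_sub_repl_col[OF F A j dim(2)] cnj_scaleR[symmetric]
  by (rule arg_cong[where f = cnj], rule rdet_sub_repl_row_scaleR[OF F(1) A j])
    (simp add: dim b cnj_scaleR)

theorem theorem4p4:
  fixes B1 A2 B2 C N :: "quat mat" and r s m p q r1 r2 r3 r4 :: nat
  assumes B1: "B1 \<in> carrier_mat r s" and rk1: "qrank B1 = r1"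
    and A2: "A2 \<in> carrier_mat m p" and rk2: "qrank A2 = r2"
    and B2: "B2 \<in> carrier_mat q s" and rk3: "qrank B2 = r3"
    and C: "C \<in> carrier_mat m s"
    and N_def: "N = B2 * L_mat B1" and rk4: "qrank N = r4"
  defines "X1 \<equiv> C * mpinv B1 - Q_mat A2 * C * mpinv N * B2 * mpinv B1"
    and "X2 \<equiv> mpinv A2 * C * mpinv N"
    and "C1 \<equiv> C * ctrans B1"
    and "C2 \<equiv> C * ctrans N"
    and "B2t \<equiv> B2 * ctrans B1"
    and "C3 \<equiv> ctrans A2 * C * ctrans N"
    and "AA \<equiv> A2 * ctrans A2"
    and "AsA \<equiv> ctrans A2 * A2"
    and "NN \<equiv> N * ctrans N"
    and "BB \<equiv> B1 * ctrans B1"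
  shows
    "(\<forall>i<m. \<forall>j<r.
        X1 $$ (i, j) =
          (\<Sum>\<alpha>\<in>Ikn r1 r j. rdet_sub j (repl_row BB j (row C1 i)) \<alpha>) / pminors r1 BB
        - (\<Sum>l<m. \<Sum>t<q.
              (\<Sum>\<alpha>\<in>Ikn r2 m l. rdet_sub l (repl_row AA l (row AA i)) \<alpha>)
            * (\<Sum>\<alpha>\<in>Ikn r4 q t. rdet_sub t (repl_row NN t (row C2 l)) \<alpha>)
            * (\<Sum>\<alpha>\<in>Ikn r1 r j. rdet_sub j (repl_row BB j (row B2t t)) \<alpha>))
          / (pminors r2 AA * pminors r4 NN * pminors r1 BB))
   \<and> (\<forall>g<p. \<forall>f<q.
        (let dA = vec q (\<lambda>l. \<Sum>\<beta>\<in>Ikn r2 p g. cdet_sub g (repl_col AsA g (col C3 l)) \<beta>);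
             dN = vec p (\<lambda>k. \<Sum>\<alpha>\<in>Ikn r4 q f. rdet_sub f (repl_row NN f (row C3 k)) \<alpha>)
         in X2 $$ (g, f) =
              (\<Sum>\<alpha>\<in>Ikn r4 q f. rdet_sub f (repl_row NN f dA) \<alpha>)
                / (pminors r2 AsA * pminors r4 NN)
          \<and> X2 $$ (g, f) =
              (\<Sum>\<beta>\<in>Ikn r2 p g. cdet_sub g (repl_col AsA g dN) \<beta>)
                / (pminors r2 AsA * pminors r4 NN)))"
proof -
  have N: "N \<in> carrier_mat q s" unfolding N_def using B2 L_mat_carrier[OF B1] by simp
  define b1 where "b1 = mpinv B1"
  define a2 where "a2 = mpinv A2"
  define nn where "nn = mpinv N"
  have b1: "b1 \<in> carrier_mat s r" and a2: "a2 \<in> carrier_mat p m" and nn: "nn \<in> carrier_mat s q"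
    unfolding b1_def a2_def nn_def using B1 A2 N by (auto intro: mpinv_carrier)
  have cB1: "ctrans B1 \<in> carrier_mat s r" and cA2: "ctrans A2 \<in> carrier_mat p m"
    and cN: "ctrans N \<in> carrier_mat s q" using B1 A2 N by auto
  obtain dB where dB: "dB \<noteq> 0" "pminors r1 BB = of_real dB"
    using ex_pminors_gram[OF B1] unfolding BB_def rk1 by blast
  obtain dN where dN: "dN \<noteq> 0" "pminors r4 NN = of_real dN"
    using ex_pminors_gram[OF N] unfolding NN_def rk4 by blast
  obtain dA where dA: "dA \<noteq> 0" "pminors r2 AA = of_real dA"
    using ex_pminors_gram[OF A2] unfolding AA_def rk2 by blast
  \<comment> \<open>\<open>AsA\<close> is the Gram matrix of \<open>ctrans A2\<close>, whose rank is
    also \<open>r2\<close>.\<close>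
  obtain dA' where dA': "dA' \<noteq> 0" "pminors r2 AsA = of_real dA'"
    using ex_pminors_gram[OF cA2] unfolding AsA_def qrank_ctrans[OF A2] rk2 by auto
  note rowB = mult_mpinv_index[OF B1, unfolded rk1, folded BB_def b1_def, unfolded dB(2) divide_of_real_quat]
  note rowN = mult_mpinv_index[OF N, unfolded rk4, folded NN_def nn_def, unfolded dN(2) divide_of_real_quat]
  note rowA = mult_mpinv_index[OF A2, unfolded rk2, folded AA_def a2_def, unfolded dA(2) divide_of_real_quat]
  note colA = mpinv_mult_index[OF A2, unfolded rk2, folded AsA_def a2_def, unfolded dA'(2) divide_of_real_quat]
  have first: "X1 $$ (i, j) =
          (\<Sum>\<alpha>\<in>Ikn r1 r j. rdet_sub j (repl_row BB j (row C1 i)) \<alpha>) / pminors r1 BB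
        - (\<Sum>l<m. \<Sum>t<q.
              (\<Sum>\<alpha>\<in>Ikn r2 m l. rdet_sub l (repl_row AA l (row AA i)) \<alpha>)
            * (\<Sum>\<alpha>\<in>Ikn r4 q t. rdet_sub t (repl_row NN t (row C2 l)) \<alpha>)
            * (\<Sum>\<alpha>\<in>Ikn r1 r j. rdet_sub j (repl_row BB j (row B2t t)) \<alpha>))
          / (pminors r2 AA * pminors r4 NN * pminors r1 BB)" if i: "i < m" and j: "j < r" for i j
  proof -
    \<comment> \<open>The subtracted term of \<open>X1\<close> is regrouped as a product of three
      matrices, each of the form covered by \<open>mult_mpinv_index\<close>; the real denominators
      then collect into one.\<close>
    define U V W where "U = A2 * a2" and "V = C * nn" and "W = B2 * b1"
    have U: "U \<in> carrier_mat m m" and V: "V \<in> carrier_mat m q" and W: "W \<in> carrier_mat q r"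
      using A2 a2 C nn B2 b1 by (auto simp: U_def V_def W_def)
    have UC: "U * C \<in> carrier_mat m s" and UV: "U * V \<in> carrier_mat m q" using U V C by auto
    have "U * C * nn * B2 * b1 = U * V * B2 * b1"
      unfolding V_def using assoc_mult_mat[OF U C nn] by simp
    also have "\<dots> = U * V * W" unfolding W_def by (rule assoc_mult_mat[OF UV B2 b1])
    also have "\<dots> = U * (V * W)" by (rule assoc_mult_mat[OF U V W])
    finally have X1: "X1 = C * b1 - U * (V * W)"
      unfolding X1_def Q_mat_def by (simp add: U_def flip: b1_def a2_def nn_def)
    have "(U * (V * W)) $$ (i, j) = (\<Sum>l<m. \<Sum>t<q. U $$ (i, l) * V $$ (l, t) * W $$ (t, j))"
      using U V W i j by (auto simp: scalar_prod_def sum_distrib_left mult.assoc lessThan_atLeast0 intro!: sum.cong)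
    also have "\<dots> = (\<Sum>l<m. \<Sum>t<q. inverse (dA * dN * dB) *\<^sub>R (
              (\<Sum>\<alpha>\<in>Ikn r2 m l. rdet_sub l (repl_row AA l (row AA i)) \<alpha>)
            * (\<Sum>\<alpha>\<in>Ikn r4 q t. rdet_sub t (repl_row NN t (row C2 l)) \<alpha>)
            * (\<Sum>\<alpha>\<in>Ikn r1 r j. rdet_sub j (repl_row BB j (row B2t t)) \<alpha>)))"
    proof (intro sum.cong refl)
      fix l t assume "l \<in> {..<m}" "t \<in> {..<q}"
      hence l: "l < m" and t: "t < q" by auto
      show "U $$ (i, l) * V $$ (l, t) * W $$ (t, j) = inverse (dA * dN * dB) *\<^sub>R (
              (\<Sum>\<alpha>\<in>Ikn r2 m l. rdet_sub l (repl_row AA l (row AA i)) \<alpha>)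
            * (\<Sum>\<alpha>\<in>Ikn r4 q t. rdet_sub t (repl_row NN t (row C2 l)) \<alpha>)
            * (\<Sum>\<alpha>\<in>Ikn r1 r j. rdet_sub j (repl_row BB j (row B2t t)) \<alpha>))"
        using rowA[OF A2 i l] rowN[OF C l t] rowB[OF B2 t j]
        by (simp only: U_def V_def W_def AA_def C2_def B2t_def mult_scaleR_left mult_scaleR_right
            scaleR_scaleR inverse_mult_distrib mult_ac)
    qed
    finally show ?thesis
      using i j C b1 U V W rowB[OF C i j]
      by (simp add: X1 dA(2) dN(2) dB(2) divide_of_real_quat C1_def
          scaleR_sum_right[symmetric] del: index_mult_mat(1) of_real_mult flip: of_real_mult)
  qed
  have second: "X2 $$ (g, f) = (\<Sum>\<alpha>\<in>Ikn r4 q f. rdet_sub f (repl_row NN f vA) \<alpha>)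
                / (pminors r2 AsA * pminors r4 NN)
          \<and> X2 $$ (g, f) = (\<Sum>\<beta>\<in>Ikn r2 p g. cdet_sub g (repl_col AsA g vN) \<beta>)
                / (pminors r2 AsA * pminors r4 NN)"
    if g: "g < p" and f: "f < q"
      and vA: "vA = vec q (\<lambda>l. \<Sum>\<beta>\<in>Ikn r2 p g. cdet_sub g (repl_col AsA g (col C3 l)) \<beta>)"
      and vN: "vN = vec p (\<lambda>k. \<Sum>\<alpha>\<in>Ikn r4 q f. rdet_sub f (repl_row NN f (row C3 k)) \<alpha>)"
    for g f vA vN
  proof
    have aC: "a2 * C \<in> carrier_mat p s" and CN: "C * ctrans N \<in> carrier_mat m q"
      and Cn: "C * nn \<in> carrier_mat m q" and AC: "ctrans A2 * C \<in> carrier_mat p s"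
      using a2 C N nn cA2 by auto
    have NNc: "NN \<in> carrier_mat q q" and AsAc: "AsA \<in> carrier_mat p p" "ctrans AsA = AsA"
      using N A2 by (auto simp: NN_def AsA_def ctrans_mult)
    have C3: "C3 = ctrans A2 * (C * ctrans N)"
      unfolding C3_def by (rule assoc_mult_mat[OF cA2 C cN])
    have X2: "X2 = a2 * C * nn" unfolding X2_def by (simp add: a2_def nn_def)
    have X2': "X2 = a2 * (C * nn)" unfolding X2 by (rule assoc_mult_mat[OF a2 C nn])
    \<comment> \<open>For the first formula \<open>X2\<close> is read as
      \<open>(a2 * C) * nn\<close>. The row to be inserted is itself given by the column formula for
      \<open>a2\<close>, and equals \<open>vA\<close> up to the real factor
      \<open>inverse dA'\<close>.\<close>
    have rA: "row (a2 * C * ctrans N) g $ l = inverse dA' *\<^sub>R vA $ l" if l: "l < q" for l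
    proof -
      have "row (a2 * C * ctrans N) g $ l = (a2 * (C * ctrans N)) $$ (g, l)"
        using g l a2 cN assoc_mult_mat[OF a2 C cN] by simp
      also have "\<dots> = inverse dA' *\<^sub>R vA $ l"
        using colA[OF CN g l] l by (simp add: vA C3)
      finally show ?thesis .
    qed
    have "X2 $$ (g, f) = inverse dN *\<^sub>R (\<Sum>\<alpha>\<in>Ikn r4 q f. rdet_sub f (repl_row NN f (row (a2 * C * ctrans N) g)) \<alpha>)"
      unfolding X2 by (rule rowN[OF aC g f])
    also have "(\<Sum>\<alpha>\<in>Ikn r4 q f. rdet_sub f (repl_row NN f (row (a2 * C * ctrans N) g)) \<alpha>)
      = (\<Sum>\<alpha>\<in>Ikn r4 q f. inverse dA' *\<^sub>R rdet_sub f (repl_row NN f vA) \<alpha>)"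
      by (intro sum.cong refl rdet_sub_repl_row_scaleR[OF NNc] rA) (auto dest: Ikn_D)
    finally show "X2 $$ (g, f) = (\<Sum>\<alpha>\<in>Ikn r4 q f. rdet_sub f (repl_row NN f vA) \<alpha>)
                / (pminors r2 AsA * pminors r4 NN)"
      unfolding dA'(2) dN(2) of_real_mult[symmetric] divide_of_real_quat
      by (simp only: scaleR_sum_right[symmetric] scaleR_scaleR inverse_mult_distrib mult.commute)
    \<comment> \<open>For the second formula \<open>X2\<close> is read as
      \<open>a2 * (C * nn)\<close>, and the inserted column is obtained from the row formula for
      \<open>nn\<close>.\<close>
    have rN: "col (ctrans A2 * (C * nn)) f $ k = inverse dN *\<^sub>R vN $ k" if k: "k < p" for k
    proof -
      have "col (ctrans A2 * (C * nn)) f $ k = (ctrans A2 * C * nn) $$ (k, f)"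
        using f k cA2 nn assoc_mult_mat[OF cA2 C nn] by simp
      also have "\<dots> = inverse dN *\<^sub>R vN $ k"
        using rowN[OF AC k f] k by (simp add: vN C3_def)
      finally show ?thesis .
    qed
    have "X2 $$ (g, f) = inverse dA' *\<^sub>R (\<Sum>\<beta>\<in>Ikn r2 p g. cdet_sub g (repl_col AsA g (col (ctrans A2 * (C * nn)) f)) \<beta>)"
      unfolding X2' by (rule colA[OF Cn g f])
    also have "(\<Sum>\<beta>\<in>Ikn r2 p g. cdet_sub g (repl_col AsA g (col (ctrans A2 * (C * nn)) f)) \<beta>)
      = (\<Sum>\<beta>\<in>Ikn r2 p g. inverse dN *\<^sub>R cdet_sub g (repl_col AsA g vN) \<beta>)"
      by (intro sum.cong refl cdet_sub_repl_col_scaleR[OF AsAc] rN)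
        (use A2 in \<open>auto simp: vN dest: Ikn_D\<close>)
    finally show "X2 $$ (g, f) = (\<Sum>\<beta>\<in>Ikn r2 p g. cdet_sub g (repl_col AsA g vN) \<beta>)
                / (pminors r2 AsA * pminors r4 NN)"
      unfolding dA'(2) dN(2) of_real_mult[symmetric] divide_of_real_quat
      by (simp only: scaleR_sum_right[symmetric] scaleR_scaleR inverse_mult_distrib)
  qed
  show ?thesis unfolding Let_def using first second by blast
qed

end
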